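(* Let $\mathbb{H}$ be a Hilbert space with orthonormal basis $\{v_i\}_{i=1}^n$, and let $L:\mathbb{H}\to\mathbb{H}$ be a linear operator with $\|Lv_i\|=1$ for all $i=1,2,\dots,n$. (Bourgain-Tzafriri Restricted Invertibility Theorem.) If we iterate the algorithm described in the context $k$ times, we get $k$ vectors from $\{Lv_i\}_{i=1}^n$ with lower Riesz bound for the operator $A$ $$1-2\epsilon-(k-1)\delta=(1-2\epsilon)\left(1-(k-1)\frac{\|L\|^2}{\epsilon n}\right).$$ Hence: 1. If $k=\left\lceil \frac{\epsilon^2 n}{\|L\|^2}\right\rceil$, then $$(1-2\epsilon)\left[1-(k-1)\frac{\|L\|^2}{\epsilon n}\right]\ge(1-2\epsilon)\left[1-\frac{\epsilon^2 n}{\|L\|^2}\frac{\|L\|^2}{\epsilon n}\right]=(1-2\epsilon)(1-\epsilon),$$ which is the Bourgain-Tzafriri theorem. 2. If $k=\left\lceil \frac{\epsilon n}{\|L\|^2}\right\rceil$, then $$(1-2\epsilon)\left[1-(k-1)\frac{\|L\|^2}{\epsilon n}\right]=(1-2\epsilon)\left[1-\frac{\epsilon n}{\|L\|^2}\frac{\|L\|^2}{\epsilon n}\right]=(1-2\epsilon)\,0,$$ and the process stops.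
   Context: $\|L\|$ is the operator norm of $L$, $Tr$ is the trace, $I$ is the identity, and $\delta=\frac{(1-2\epsilon)\|L\|^2}{\epsilon n}$. The algorithm (Spielman and Srivastava, with adjusted constants) keeps an operator $A$, the sum of $ww^T$ over the vectors $w\in\{Lv_i\}_{i=1}^n$ chosen so far, and a barrier $b$. It starts with no vectors chosen ($A=0$) and barrier $b=1-2\epsilon$. One iteration applies when $A$ is a sum of $m$ such terms and has $m$ non-zero eigenvalues, all greater than $b$, when $b'=b-\delta>\delta$, and when $Tr[L^T(A-bI)^{-1}L]\le -n-\frac{2\|L\|^2}{\delta}$. It picks a vector $\omega\in\{Lv_i\}_{i=1}^n$, not among those already chosen, with $\omega^T(A-b'I)^{-1}\omega<-1$ and $Tr[L^T(A+\omega\omega^T-b'I)^{-1}L]\le Tr[L^T(A-bI)^{-1}L]$. It then replaces $A$ by $A+\omega\omega^T$ and $b$ by $b'$. The lower Riesz bound for $A$ is a lower bound for the non-zero eigenvalues of $A$, equivalently a constant $c$ with $\|\sum_w a_w w\|^2\ge c\sum_w|a_w|^2$ for all scalars $a_w$, the sums being over the chosen vectors $w$.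
   Formalization: The bound 1-2ε-(k-1)δ is proved for suitable picks of the algorithm; arbitrary picks get 1-2ε-kδ, as the (k-1)-bound can fail for them. In item 2 the first "=" is false and becomes "≥", with the barrier at most 0 after k steps. It is assumed that 0<ε<1/2. *)

theory Defs
  imports "HOL-Analysis.Analysis"
begin

text \<open>
  The finite-dimensional Hilbert space is a type of class \<^class>\<open>euclidean_space\<close>.  The
  orthonormal basis \<open>v\<^sub>1, \<dots>, v\<^sub>n\<close> is an arbitrary one, unrelated to the distinguished
  set \<^term>\<open>Basis\<close> of the class.
\<close>

definition orthonormal_basis :: "(nat \<Rightarrow> 'a::euclidean_space) \<Rightarrow> nat \<Rightarrow> bool" where
  "orthonormal_basis v n \<longleftrightarrow>
     (\<forall>i\<in>{1..n}. \<forall>j\<in>{1..n}. v i \<bullet> v j = (if i = j then 1 else 0)) \<and>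
     span (v ` {1..n}) = UNIV"

definition op_trace :: "('a::euclidean_space \<Rightarrow> 'a) \<Rightarrow> real" where
  "op_trace T = (\<Sum>e\<in>Basis. T e \<bullet> e)"

definition eigenspace :: "('a::euclidean_space \<Rightarrow> 'a) \<Rightarrow> real \<Rightarrow> 'a set" where
  "eigenspace T \<mu> = {x. T x = \<mu> *\<^sub>R x}"

definition nonzero_eigenvalues :: "('a::euclidean_space \<Rightarrow> 'a) \<Rightarrow> real set" where
  "nonzero_eigenvalues T = {\<mu>. \<mu> \<noteq> 0 \<and> (\<exists>x. x \<noteq> 0 \<and> T x = \<mu> *\<^sub>R x)}"

text \<open>Eigenvalues are counted with multiplicity.\<close>

definition num_nonzero_eigenvalues :: "('a::euclidean_space \<Rightarrow> 'a) \<Rightarrow> nat" where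
  "num_nonzero_eigenvalues T = (\<Sum>\<mu>\<in>nonzero_eigenvalues T. dim (eigenspace T \<mu>))"

text \<open>The operator \<open>A = \<Sum>\<^bsub>w \<in> W\<^esub> w w\<^sup>T\<close>.\<close>

definition frame_op :: "'a::euclidean_space set \<Rightarrow> 'a \<Rightarrow> 'a" where
  "frame_op W x = (\<Sum>w\<in>W. (w \<bullet> x) *\<^sub>R w)"

text \<open>
  The operator \<open>(A - b I)\<^sup>-\<^sup>1\<close>.  The inverse function is the operator inverse only if
  \<open>A - b I\<close> is bijective, i.e. \<open>b\<close> is not an eigenvalue of \<open>A\<close>; this is the case wherever
  the algorithm below selects a vector.
\<close>

definition shifted_inverse :: "('a::euclidean_space \<Rightarrow> 'a) \<Rightarrow> real \<Rightarrow> 'a \<Rightarrow> 'a" where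
  "shifted_inverse A b = inv (\<lambda>x. A x - b *\<^sub>R x)"

text \<open>\<open>Tr [L\<^sup>T (A - b I)\<^sup>-\<^sup>1 L]\<close>\<close>

definition potential :: "('a::euclidean_space \<Rightarrow> 'a) \<Rightarrow> ('a \<Rightarrow> 'a) \<Rightarrow> real \<Rightarrow> real" where
  "potential L A b = op_trace (adjoint L \<circ> shifted_inverse A b \<circ> L)"

definition ss_delta :: "('a::euclidean_space \<Rightarrow> 'a) \<Rightarrow> nat \<Rightarrow> real \<Rightarrow> real" where
  "ss_delta L n \<epsilon> = (1 - 2 * \<epsilon>) * (onorm L)\<^sup>2 / (\<epsilon> * real n)"

definition ss_applies ::
    "('a::euclidean_space \<Rightarrow> 'a) \<Rightarrow> nat \<Rightarrow> real \<Rightarrow> 'a set \<Rightarrow> real \<Rightarrow> bool" where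
  "ss_applies L n \<epsilon> W b \<longleftrightarrow>
     num_nonzero_eigenvalues (frame_op W) = card W \<and>
     (\<forall>\<mu>\<in>nonzero_eigenvalues (frame_op W). \<mu> > b) \<and>
     b - ss_delta L n \<epsilon> > ss_delta L n \<epsilon> \<and>
     potential L (frame_op W) b \<le> - real n - 2 * (onorm L)\<^sup>2 / ss_delta L n \<epsilon>"

definition ss_choice ::
    "('a::euclidean_space \<Rightarrow> 'a) \<Rightarrow> (nat \<Rightarrow> 'a) \<Rightarrow> nat \<Rightarrow> real \<Rightarrow> 'a set \<Rightarrow> real \<Rightarrow> 'a \<Rightarrow> bool" where
  "ss_choice L v n \<epsilon> W b \<omega> \<longleftrightarrow>
     \<omega> \<in> (\<lambda>i. L (v i)) ` {1..n} \<and> \<omega> \<notin> W \<and>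
     \<omega> \<bullet> shifted_inverse (frame_op W) (b - ss_delta L n \<epsilon>) \<omega> < - 1 \<and>
     potential L (\<lambda>x. frame_op W x + (\<omega> \<bullet> x) *\<^sub>R \<omega>) (b - ss_delta L n \<epsilon>)
       \<le> potential L (frame_op W) b"

text \<open>
  \<open>ss_run L v n \<epsilon> k W b\<close>: some execution of \<open>k\<close> iterations of the algorithm, each of them
  applicable, ends with the set \<open>W\<close> of chosen vectors and the barrier \<open>b\<close>.  The selection in
  an iteration is nondeterministic.
\<close>

inductive ss_run ::
    "('a::euclidean_space \<Rightarrow> 'a) \<Rightarrow> (nat \<Rightarrow> 'a) \<Rightarrow> nat \<Rightarrow> real \<Rightarrow> nat \<Rightarrow> 'a set \<Rightarrow> real \<Rightarrow> bool"
  for L v n \<epsilon> where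
  start: "ss_run L v n \<epsilon> 0 {} (1 - 2 * \<epsilon>)"
| iterate: "ss_run L v n \<epsilon> k W b \<Longrightarrow> ss_applies L n \<epsilon> W b \<Longrightarrow> ss_choice L v n \<epsilon> W b \<omega> \<Longrightarrow>
     ss_run L v n \<epsilon> (Suc k) (insert \<omega> W) (b - ss_delta L n \<epsilon>)"

text \<open>
  Lower Riesz bound, both as a lower bound for the non-zero eigenvalues of the operator
  \<open>\<Sum>\<^bsub>w \<in> W\<^esub> w w\<^sup>T\<close> and as a lower bound for the norms of linear combinations.  The two agree
  for linearly independent \<open>W\<close>; in general, for \<open>c > 0\<close>, the second one implies the first.
\<close>

definition lower_riesz_bound :: "'a::euclidean_space set \<Rightarrow> real \<Rightarrow> bool" where
  "lower_riesz_bound W c \<longleftrightarrow>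
     (\<forall>\<mu>\<in>nonzero_eigenvalues (frame_op W). c \<le> \<mu>) \<and>
     (\<forall>a. c * (\<Sum>w\<in>W. \<bar>a w\<bar>\<^sup>2) \<le> (norm (\<Sum>w\<in>W. a w *\<^sub>R w))\<^sup>2)"

definition selects ::
    "('a::euclidean_space \<Rightarrow> 'a) \<Rightarrow> (nat \<Rightarrow> 'a) \<Rightarrow> nat \<Rightarrow> nat \<Rightarrow> 'a set \<Rightarrow> bool" where
  "selects L v n k W \<longleftrightarrow> W \<subseteq> (\<lambda>i. L (v i)) ` {1..n} \<and> card W = k"

end

theory Submission
  imports Defs
begin

text \<open>
  The barrier argument of Spielman and Srivastava.  Let \<open>A\<close> be the frame operator of the chosen
  vectors and \<open>b\<close> the barrier.  By the secular equation (\<open>secular_equation\<close>), the numbers \<open>\<mu>\<close> that are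
  eigenvalues of \<open>A + \<omega> \<omega>\<^sup>T\<close> but not of \<open>A\<close> satisfy \<open>\<omega>\<^sup>T (A - \<mu> I)\<^sup>-\<^sup>1 \<omega> = - 1\<close>.  The left-hand side
  increases strictly as long as \<open>\<mu>\<close> stays between \<open>0\<close> and the nonzero eigenvalues of \<open>A\<close>, so if its value
  at \<open>b\<close> is below \<open>-1\<close>, then all nonzero eigenvalues of \<open>A + \<omega> \<omega>\<^sup>T\<close>, including the new one, exceed \<open>b\<close>
  (\<open>update_eigenvalue_gt\<close>).  The same hypothesis puts \<open>\<omega>\<close> outside the span of the earlier vectors, where
  the form is nonnegative, so the chosen vectors remain linearly independent.  For independent
  vectors a lower bound for the nonzero eigenvalues of the frame operator is a lower Riesz bound
  (\<open>eigenvalue_bound_imp_riesz\<close>).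

  The potential is the sum of \<open>\<omega>\<^sup>T (A - b I)\<^sup>-\<^sup>1 \<omega>\<close> over the \<open>n\<close> candidates \<open>\<omega> = L (v i)\<close>, so an upper bound
  for it makes the form small for some candidate.  That this candidate can also be
  taken to keep the potential from growing, while the barrier drops by \<open>\<delta>\<close>, is shown by a second
  averaging, based on the Sherman--Morrison formula (\<open>exists_selection\<close>).  Candidates already chosen
  lie in the span of the chosen vectors, and so they are not selected again.

  The invariant of the algorithm only yields the barrier after \<open>k\<close> steps, \<open>1 - 2 \<epsilon> - k \<delta>\<close>, as a bound.
  The bound \<open>1 - 2 \<epsilon> - (k - 1) \<delta>\<close> is the barrier before the last step.  It is obtained because the
  averaging leaves enough slack to require \<open>\<omega>\<^sup>T (A - b I)\<^sup>-\<^sup>1 \<omega> \<le> - 1\<close> at the old barrier as well; then no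
  nonzero eigenvalue of the update lies below \<open>b\<close> (\<open>update_eigenvalue_ge\<close>).

  For the Bourgain--Tzafriri bound, \<open>k - 1\<close> iterations suffice, since the last vector may
  be added without preparing the potential for a further step (\<open>extra_vector\<close>).  In the
  second case the barrier after \<open>k\<close> steps would not be positive, whereas an applicable step leaves a
  barrier above \<open>\<delta>\<close>.
\<close>

section \<open>Orthonormal bases and the spectral theorem\<close>

text \<open>
  Bases are sets here, in contrast to the indexed families of \<^const>\<open>orthonormal_basis\<close>, so that the
  distinguished \<^const>\<open>Basis\<close> and bases of eigenvectors are covered alike.
\<close>

definition is_onb :: "'a::euclidean_space set \<Rightarrow> bool" where
  "is_onb B \<longleftrightarrow> pairwise orthogonal B \<and> (\<forall>b\<in>B. norm b = 1) \<and> span B = UNIV"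

lemma is_onb_Basis: "is_onb (Basis :: 'a::euclidean_space set)"
  unfolding is_onb_def
  by (auto simp: pairwise_def orthogonal_def inner_not_same_Basis)

lemma is_onb_finite: "is_onb B \<Longrightarrow> finite B"
  unfolding is_onb_def by (blast intro: pairwise_orthogonal_imp_finite)

lemma is_onb_inner_members:
  assumes "is_onb B" "b \<in> B" "c \<in> B"
  shows "b \<bullet> c = (if b = c then 1 else 0)"
  using assms unfolding is_onb_def pairwise_def orthogonal_def
  by (auto simp: dot_square_norm)

lemma is_onb_expand:
  assumes "is_onb B"
  shows "(\<Sum>b\<in>B. (x \<bullet> b) *\<^sub>R b) = x"
  using assms is_onb_finite[OF assms] unfolding is_onb_def
  by (intro orthonormal_basis_expand) auto

lemma parseval_inner:
  assumes "is_onb B"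
  shows "x \<bullet> y = (\<Sum>b\<in>B. (x \<bullet> b) * (y \<bullet> b))"
proof -
  have "x \<bullet> y = x \<bullet> (\<Sum>b\<in>B. (y \<bullet> b) *\<^sub>R b)"
    by (simp add: is_onb_expand[OF assms])
  also have "\<dots> = (\<Sum>b\<in>B. (x \<bullet> b) * (y \<bullet> b))"
    by (simp add: inner_sum_right mult.commute)
  finally show ?thesis .
qed

lemma parseval_norm:
  assumes "is_onb B"
  shows "(norm x)\<^sup>2 = (\<Sum>b\<in>B. (x \<bullet> b)\<^sup>2)"
  unfolding power2_norm_eq_inner parseval_inner[OF assms, of x x]
  by (simp add: power2_eq_square)

lemma onb_eqI:
  assumes "is_onb B" "\<And>b. b \<in> B \<Longrightarrow> x \<bullet> b = y \<bullet> b"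
  shows "x = y"
proof -
  have "(\<Sum>b\<in>B. (x \<bullet> b) *\<^sub>R b) = (\<Sum>b\<in>B. (y \<bullet> b) *\<^sub>R b)"
    using assms(2) by simp
  then show ?thesis by (simp add: is_onb_expand[OF assms(1)])
qed

lemma is_onb_independent:
  assumes "is_onb B" "F \<subseteq> B"
  shows "independent F"
proof (rule independent_mono[OF _ assms(2)])
  show "independent B"
    using assms(1) unfolding is_onb_def by (intro pairwise_orthogonal_independent) auto
qed

lemma orthonormal_basis_is_onb:
  assumes "orthonormal_basis v n"
  shows "inj_on v {1..n}" and "is_onb (v ` {1..n})"
proof -
  have ip: "v i \<bullet> v j = (if i = j then 1 else 0)" if "i \<in> {1..n}" "j \<in> {1..n}" for i j
    using assms that unfolding orthonormal_basis_def by blast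
  show "inj_on v {1..n}"
  proof (rule inj_onI)
    fix i j assume ij: "i \<in> {1..n}" "j \<in> {1..n}" "v i = v j"
    show "i = j" using ip[OF ij(1,2)] ip[OF ij(1,1)] ij(3) by (auto split: if_splits)
  qed
  have "norm (v i) = 1" if "i \<in> {1..n}" for i
    using ip[OF that that] by (simp add: norm_eq_sqrt_inner)
  moreover have "pairwise orthogonal (v ` {1..n})"
    unfolding pairwise_def orthogonal_def using ip by (auto split: if_splits)
  ultimately show "is_onb (v ` {1..n})"
    using assms unfolding is_onb_def orthonormal_basis_def by auto
qed

lemma parseval_orthonormal_basis:
  assumes "orthonormal_basis v n"
  shows "(norm x)\<^sup>2 = (\<Sum>i\<in>{1..n}. (x \<bullet> v i)\<^sup>2)"
  unfolding parseval_norm[OF orthonormal_basis_is_onb(2)[OF assms], of x]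
  by (subst sum.reindex[OF orthonormal_basis_is_onb(1)[OF assms]]) simp

text \<open>
  A quadratic polynomial that vanishes at \<open>0\<close> and has a linear term changes sign there.
\<close>

lemma linear_coefficient_zero:
  fixes a c :: real
  assumes "\<And>t. 0 \<le> 2 * t * a + t\<^sup>2 * c"
  shows "a = 0"
proof (rule ccontr)
  assume a: "a \<noteq> 0"
  \<comment> \<open>At \<open>t = - a / k\<close> with \<open>k > c\<close> the linear term outweighs the quadratic one.\<close>
  define k where "k = \<bar>c\<bar> + 1"
  have k: "k > 0" "c < k" unfolding k_def by auto
  have "0 \<le> 2 * (- a / k) * a + (- a / k)\<^sup>2 * c" by (rule assms)
  also have "\<dots> = a\<^sup>2 / k * (c / k - 2)"
    using k by (simp add: field_simps power2_eq_square)
  also have "\<dots> < 0"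
  proof (rule mult_pos_neg)
    have "c / k < 1" using k by simp
    then show "c / k - 2 < 0" by simp
  qed (use a k in simp)
  finally show False by simp
qed

text \<open>
  On the compact unit sphere of \<open>S\<close> the Rayleigh quotient \<open>x \<bullet> T x\<close> attains a maximum \<open>\<mu>\<close> at some \<open>u\<close>.
  Then \<open>N = \<mu> I - T\<close> is positive semidefinite on \<open>S\<close> and \<open>u \<bullet> N u = 0\<close>, so moving from \<open>u\<close> in the
  direction \<open>N u\<close> cannot decrease the form; the first-order term of this motion is \<open>2 \<parallel>N u\<parallel>\<^sup>2\<close>.
\<close>

lemma rayleigh_maximizer:
  fixes T :: "'a::euclidean_space \<Rightarrow> 'a"
  assumes lin: "linear T" and sym: "\<And>x y. T x \<bullet> y = x \<bullet> T y"
    and S: "subspace S" "T ` S \<subseteq> S" "S \<noteq> {0}"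
  obtains u \<mu> where "u \<in> S" "norm u = 1" "T u = \<mu> *\<^sub>R u"
proof -
  let ?K = "S \<inter> sphere 0 1"
  have "compact ?K" by (simp add: closed_Int_compact closed_subspace S(1))
  moreover obtain x where x: "x \<in> S" "x \<noteq> 0" using S(1,3) subspace_0 by blast
  have "x /\<^sub>R norm x \<in> ?K" using x S(1) by (simp add: subspace_scale)
  then have "?K \<noteq> {}" by blast
  moreover have "continuous_on ?K (\<lambda>x. x \<bullet> T x)"
    by (intro continuous_intros linear_continuous_on linear_conv_bounded_linear[THEN iffD1] lin)
  ultimately obtain u where u: "u \<in> ?K" and max: "\<And>y. y \<in> ?K \<Longrightarrow> y \<bullet> T y \<le> u \<bullet> T u"
    using continuous_attains_sup[of ?K "\<lambda>x. x \<bullet> T x"] by blast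
  define \<mu> where "\<mu> = u \<bullet> T u"
  define N where "N x = \<mu> *\<^sub>R x - T x" for x
  have N_psd: "0 \<le> y \<bullet> N y" if "y \<in> S" for y
  proof (cases "y = 0")
    case False
    have "y /\<^sub>R norm y \<in> ?K" using that False S(1) by (simp add: subspace_scale)
    from max[OF this] have "(y \<bullet> T y) / (norm y)\<^sup>2 \<le> \<mu>"
      by (simp add: \<mu>_def linear_scale[OF lin] power2_eq_square divide_inverse ac_simps)
    then have "y \<bullet> T y \<le> \<mu> * (norm y)\<^sup>2" using False by (simp add: divide_le_eq)
    then show ?thesis by (simp add: N_def inner_diff_right power2_norm_eq_inner)
  qed (simp add: N_def linear_0[OF lin])
  have uS: "u \<in> S" "norm u = 1" using u by auto
  have N_S: "N y \<in> S" if "y \<in> S" for y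
    unfolding N_def using that S by (auto intro!: subspace_diff subspace_scale)
  have uN: "u \<bullet> N u = 0"
    using uS(2) by (simp add: N_def \<mu>_def inner_diff_right norm_eq_1)
  have "N u \<bullet> N u = 0"
  proof (rule linear_coefficient_zero[where c = "N u \<bullet> N (N u)"])
    fix t
    have "u + t *\<^sub>R N u \<in> S" using uS N_S S(1) by (simp add: subspace_add subspace_scale)
    from N_psd[OF this] have "0 \<le> (u + t *\<^sub>R N u) \<bullet> N (u + t *\<^sub>R N u)" .
    also have "N (u + t *\<^sub>R N u) = N u + t *\<^sub>R N (N u)"
      by (simp add: N_def linear_add[OF lin] linear_scale[OF lin] linear_diff[OF lin] algebra_simps)
    also have "(u + t *\<^sub>R N u) \<bullet> \<dots> = u \<bullet> N u + t * (u \<bullet> N (N u)) + t * (N u \<bullet> N u) + t\<^sup>2 * (N u \<bullet> N (N u))"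
      by (simp add: inner_add_left inner_add_right power2_eq_square algebra_simps)
    also have "u \<bullet> N z = N u \<bullet> z" for z
      by (simp add: N_def inner_diff_right inner_diff_left sym)
    finally show "0 \<le> 2 * t * (N u \<bullet> N u) + t\<^sup>2 * (N u \<bullet> N (N u))" using uN by simp
  qed
  then have "T u = \<mu> *\<^sub>R u" by (simp add: N_def)
  then show ?thesis using that uS by blast
qed

text \<open>
  By symmetry of \<open>T\<close>, the orthogonal complement in \<open>S\<close> of an eigenvector is again invariant, so
  eigenvectors can be split off one at a time.
\<close>

lemma invariant_subspace_eigenbasis:
  fixes T :: "'a::euclidean_space \<Rightarrow> 'a"
  assumes lin: "linear T" and sym: "\<And>x y. T x \<bullet> y = x \<bullet> T y"
    and S: "subspace S" "T ` S \<subseteq> S"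
  shows "\<exists>E. pairwise orthogonal E \<and> (\<forall>e\<in>E. norm e = 1) \<and> span E = S \<and>
             (\<forall>e\<in>E. \<exists>\<mu>. T e = \<mu> *\<^sub>R e)"
  using S
proof (induction "dim S" arbitrary: S rule: less_induct)
  case less
  show ?case
  proof (cases "S = {0}")
    case True
    then show ?thesis by (intro exI[of _ "{}"]) simp
  next
    case False
    obtain u \<mu> where u: "u \<in> S" "norm u = 1" "T u = \<mu> *\<^sub>R u"
      using rayleigh_maximizer[OF lin sym less.prems False] by blast
    have uu: "u \<bullet> u = 1" using u(2) by (simp add: norm_eq_1)
    define S' where "S' = S \<inter> {x. orthogonal u x}"
    have sub: "subspace S'"
      unfolding S'_def by (intro subspace_inter less.prems subspace_orthogonal_to_vector)
    have inv: "T ` S' \<subseteq> S'"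
      using less.prems(2) u(3) sym unfolding S'_def orthogonal_def
      by (auto simp flip: sym)
    have "u \<notin> S'" using uu by (auto simp: S'_def orthogonal_def)
    then have "dim S' < dim S"
      using u(1) sub less.prems(1) unfolding S'_def
      by (intro dim_psubset) (auto simp: span_eq_iff[THEN iffD2])
    from less.hyps[OF this sub inv] obtain E where
      E: "pairwise orthogonal E" "\<forall>e\<in>E. norm e = 1" "span E = S'" "\<forall>e\<in>E. \<exists>\<mu>. T e = \<mu> *\<^sub>R e"
      by blast
    have ES: "E \<subseteq> S'" using E(3) span_superset by blast
    have "span (insert u E) = S"
    proof (rule antisym)
      show "span (insert u E) \<subseteq> S"
        using ES u(1) less.prems(1) by (intro span_minimal) (auto simp: S'_def)
      show "S \<subseteq> span (insert u E)"
      proof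
        fix x assume x: "x \<in> S"
        have "x - (u \<bullet> x) *\<^sub>R u \<in> S'"
          using x u(1) less.prems(1) uu
          by (auto simp: S'_def orthogonal_def inner_diff_right intro!: subspace_diff subspace_scale)
        then show "x \<in> span (insert u E)"
          unfolding E(3)[symmetric] span_breakdown_eq by blast
      qed
    qed
    moreover have "pairwise orthogonal (insert u E)"
      using E(1) ES unfolding pairwise_insert S'_def by (auto simp: orthogonal_commute)
    ultimately show ?thesis using E u by (intro exI[of _ "insert u E"]) auto
  qed
qed

locale eigenbasis =
  fixes T :: "'a::euclidean_space \<Rightarrow> 'a" and E :: "'a set" and ev :: "'a \<Rightarrow> real"
  assumes linear_T: "linear T" and onb: "is_onb E"
    and eigenvector: "\<And>e. e \<in> E \<Longrightarrow> T e = ev e *\<^sub>R e"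

theorem spectral_theorem:
  fixes T :: "'a::euclidean_space \<Rightarrow> 'a"
  assumes lin: "linear T" and sym: "\<And>x y. T x \<bullet> y = x \<bullet> T y"
  obtains E ev where "eigenbasis T E ev"
proof -
  obtain E where E: "is_onb E" "\<forall>e\<in>E. \<exists>\<mu>. T e = \<mu> *\<^sub>R e"
    using invariant_subspace_eigenbasis[OF lin sym, of UNIV] unfolding is_onb_def by auto
  then obtain ev where "\<forall>e\<in>E. T e = ev e *\<^sub>R e" by metis
  with E(1) lin have "eigenbasis T E ev" by (simp add: eigenbasis_def)
  then show ?thesis by (rule that)
qed

section \<open>Resolvent and potential in an eigenbasis\<close>

lemma onb_sum_inner:
  assumes "is_onb B" "c \<in> B"
  shows "(\<Sum>b\<in>B. f b *\<^sub>R b) \<bullet> c = f c"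
proof -
  have "(\<Sum>b\<in>B. f b *\<^sub>R b) \<bullet> c = (\<Sum>b\<in>B. if b = c then f b else 0)"
    unfolding inner_sum_left
    by (intro sum.cong) (auto simp: is_onb_inner_members[OF assms(1) _ assms(2)])
  then show ?thesis using assms(2) is_onb_finite[OF assms(1)] by simp
qed

text \<open>
  In finite dimension a right inverse is two-sided.  The resolvent is identified in this way, from
  a formula for it.
\<close>

lemma inv_eq_right_inverse:
  fixes f :: "'a::euclidean_space \<Rightarrow> 'a"
  assumes "linear f" "\<And>x. f (g x) = x"
  shows "inv f = g"
proof (rule inv_equality)
  show "f (g x) = x" for x by (rule assms(2))
  have "surj f" using assms(2) by (metis surjI)
  then have "inj f" using linear_surjective_imp_injective[OF assms(1)] by blast
  then show "g (f x) = x" for x using assms(2) by (metis injD)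
qed

lemma norm_adjoint_le:
  fixes L :: "'a::euclidean_space \<Rightarrow> 'a"
  assumes lin: "linear L"
  shows "norm (adjoint L y) \<le> onorm L * norm y"
proof (cases "adjoint L y = 0")
  case True
  then show ?thesis using lin by (simp add: onorm_pos_le linear_conv_bounded_linear)
next
  case False
  have "norm (adjoint L y) * norm (adjoint L y) = L (adjoint L y) \<bullet> y"
    by (simp flip: adjoint_works[OF lin] power2_norm_eq_inner add: power2_eq_square)
  also have "\<dots> \<le> norm (L (adjoint L y)) * norm y" by (rule norm_cauchy_schwarz)
  also have "\<dots> \<le> (onorm L * norm (adjoint L y)) * norm y"
    using lin by (intro mult_right_mono onorm) (auto simp: linear_conv_bounded_linear)
  finally show ?thesis using False by (simp add: mult.commute mult.left_commute)
qed

context eigenbasis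
begin

lemma finite_E: "finite E"
  by (rule is_onb_finite[OF onb])

lemma T_inner_eigenvector:
  assumes "e \<in> E"
  shows "T x \<bullet> e = ev e * (x \<bullet> e)"
proof -
  have "T x = (\<Sum>b\<in>E. (x \<bullet> b) *\<^sub>R T b)"
    by (subst is_onb_expand[OF onb, of x, symmetric])
       (simp add: linear_sum[OF linear_T] linear_scale[OF linear_T])
  also have "\<dots> = (\<Sum>b\<in>E. ((x \<bullet> b) * ev b) *\<^sub>R b)"
    by (intro sum.cong) (auto simp: eigenvector)
  finally show ?thesis by (simp add: onb_sum_inner[OF onb assms])
qed

lemma quadratic_form: "x \<bullet> T x = (\<Sum>e\<in>E. ev e * (x \<bullet> e)\<^sup>2)"
  by (subst parseval_inner[OF onb], intro sum.cong) (auto simp: T_inner_eigenvector power2_eq_square)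

lemma eigenvalue_in_spectrum:
  assumes "T x = \<mu> *\<^sub>R x" "x \<noteq> 0"
  shows "\<mu> \<in> ev ` E"
proof -
  obtain e where e: "e \<in> E" "x \<bullet> e \<noteq> 0"
    using onb_eqI[OF onb, of x 0] assms(2) by auto
  have "ev e * (x \<bullet> e) = \<mu> * (x \<bullet> e)"
    using T_inner_eigenvector[OF e(1), of x] assms(1) by (metis inner_scaleR_left)
  then have "\<mu> = ev e" using e(2) by simp
  then show ?thesis using e(1) by blast
qed

lemma nonzero_eigenvalues_eq: "nonzero_eigenvalues T = ev ` E - {0}"
proof
  show "nonzero_eigenvalues T \<subseteq> ev ` E - {0}"
    using eigenvalue_in_spectrum unfolding nonzero_eigenvalues_def by blast
  have "e \<noteq> 0" if "e \<in> E" for e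
    using onb that by (auto simp: is_onb_def)
  then show "ev ` E - {0} \<subseteq> nonzero_eigenvalues T"
    using eigenvector unfolding nonzero_eigenvalues_def by fastforce
qed

lemma eigenspace_eq: "eigenspace T \<mu> = span {e \<in> E. ev e = \<mu>}"
proof
  show "eigenspace T \<mu> \<subseteq> span {e \<in> E. ev e = \<mu>}"
  proof
    fix x assume "x \<in> eigenspace T \<mu>"
    then have Tx: "T x = \<mu> *\<^sub>R x" by (simp add: eigenspace_def)
    have "x \<bullet> e = 0" if "e \<in> E" "ev e \<noteq> \<mu>" for e
      using T_inner_eigenvector[OF that(1), of x] Tx that(2) by simp
    then have "x = (\<Sum>e\<in>{e \<in> E. ev e = \<mu>}. (x \<bullet> e) *\<^sub>R e)"
      by (subst is_onb_expand[OF onb, of x, symmetric], intro sum.mono_neutral_right)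
         (auto simp: finite_E)
    also have "\<dots> \<in> span {e \<in> E. ev e = \<mu>}"
      by (intro span_sum span_scale span_base)
    finally show "x \<in> span {e \<in> E. ev e = \<mu>}" .
  qed
  have "subspace (eigenspace T \<mu>)"
    by (auto simp: subspace_def eigenspace_def linear_0[OF linear_T] linear_add[OF linear_T]
        linear_scale[OF linear_T] algebra_simps)
  then show "span {e \<in> E. ev e = \<mu>} \<subseteq> eigenspace T \<mu>"
    by (intro span_minimal) (auto simp: eigenspace_def eigenvector)
qed

text \<open>
  The eigenspaces group the eigenbasis by eigenvalue, so counting with multiplicity is counting
  basis vectors.
\<close>

lemma num_nonzero_eigenvalues_eq: "num_nonzero_eigenvalues T = card {e \<in> E. ev e \<noteq> 0}"
proof -
  have "num_nonzero_eigenvalues T = (\<Sum>\<mu>\<in>ev ` {e \<in> E. ev e \<noteq> 0}. card {e \<in> E. ev e = \<mu>})"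
    unfolding num_nonzero_eigenvalues_def nonzero_eigenvalues_eq eigenspace_eq
    by (intro sum.cong) (auto simp: dim_eq_card_independent is_onb_independent[OF onb])
  also have "\<dots> = (\<Sum>\<mu>\<in>ev ` {e \<in> E. ev e \<noteq> 0}. \<Sum>e\<in>{e \<in> {e \<in> E. ev e \<noteq> 0}. ev e = \<mu>}. 1)"
    by (intro sum.cong refl) (auto simp flip: card_eq_sum intro!: arg_cong[where f = card])
  also have "\<dots> = (\<Sum>e\<in>{e \<in> E. ev e \<noteq> 0}. 1)"
    by (rule sum.image_gen[symmetric]) (simp add: finite_E)
  finally show ?thesis by simp
qed

text \<open>
  The resolvent is diagonal in the eigenbasis.
\<close>

lemma shifted_inverse:
  assumes c: "c \<notin> ev ` E"
  shows shifted_inverse_inner: "e \<in> E \<Longrightarrow> shifted_inverse T c x \<bullet> e = (x \<bullet> e) / (ev e - c)"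
    and shifted_inverse_right: "T (shifted_inverse T c x) - c *\<^sub>R shifted_inverse T c x = x"
proof -
  \<comment> \<open>The candidate for the inverse, with diagonal entries \<open>1 / (ev e - c)\<close>.\<close>
  define R where "R x = (\<Sum>e\<in>E. ((x \<bullet> e) / (ev e - c)) *\<^sub>R e)" for x
  have R: "R x \<bullet> e = (x \<bullet> e) / (ev e - c)" if "e \<in> E" for x e
    unfolding R_def by (rule onb_sum_inner[OF onb that])
  have right: "T (R x) - c *\<^sub>R R x = x" for x
  proof (rule onb_eqI[OF onb])
    fix e assume e: "e \<in> E"
    then have "ev e - c \<noteq> 0" using c by auto
    have "(T (R x) - c *\<^sub>R R x) \<bullet> e = (ev e - c) * (R x \<bullet> e)"
      by (simp add: inner_diff_left T_inner_eigenvector[OF e] left_diff_distrib)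
    also have "\<dots> = x \<bullet> e" using \<open>ev e - c \<noteq> 0\<close> by (simp add: R[OF e])
    finally show "(T (R x) - c *\<^sub>R R x) \<bullet> e = x \<bullet> e" .
  qed
  have "linear (\<lambda>x. T x - c *\<^sub>R x)"
    by (intro linear_compose_sub linear_T) (simp add: linear_iff algebra_simps)
  then have "shifted_inverse T c = R"
    unfolding shifted_inverse_def using right by (rule inv_eq_right_inverse)
  then show "e \<in> E \<Longrightarrow> shifted_inverse T c x \<bullet> e = (x \<bullet> e) / (ev e - c)"
    and "T (shifted_inverse T c x) - c *\<^sub>R shifted_inverse T c x = x"
    using R right by auto
qed

lemma inner_shifted_inverse:
  assumes "c \<notin> ev ` E"
  shows "y \<bullet> shifted_inverse T c x = (\<Sum>e\<in>E. (y \<bullet> e) * (x \<bullet> e) / (ev e - c))"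
  by (subst parseval_inner[OF onb], intro sum.cong) (auto simp: shifted_inverse_inner[OF assms])

lemma inner_shifted_inverse_commute:
  assumes "c \<notin> ev ` E"
  shows "y \<bullet> shifted_inverse T c x = x \<bullet> shifted_inverse T c y"
  by (simp add: inner_shifted_inverse[OF assms] mult.commute)

lemma quadratic_shifted_inverse:
  assumes "c \<notin> ev ` E"
  shows "x \<bullet> shifted_inverse T c x = (\<Sum>e\<in>E. (x \<bullet> e)\<^sup>2 / (ev e - c))"
  by (simp add: inner_shifted_inverse[OF assms] power2_eq_square)

lemma sum_inner_onb_image:
  fixes L :: "'a \<Rightarrow> 'a"
  assumes "linear L" "orthonormal_basis v n"
  shows "(\<Sum>i\<in>{1..n}. (L (v i) \<bullet> y)\<^sup>2) = (norm (adjoint L y))\<^sup>2"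
  unfolding parseval_orthonormal_basis[OF assms(2), of "adjoint L y"]
  by (intro sum.cong) (auto simp: adjoint_clauses[OF assms(1)] inner_commute)

lemma potential_eq_quadratic:
  fixes L :: "'a \<Rightarrow> 'a"
  assumes "linear L"
  shows "potential L A c = (\<Sum>f\<in>Basis. L f \<bullet> shifted_inverse A c (L f))"
  unfolding potential_def op_trace_def
  by (simp add: adjoint_clauses[OF assms] inner_commute)

lemma potential_eq:
  assumes lin: "linear L" and c: "c \<notin> ev ` E"
  shows "potential L T c = (\<Sum>e\<in>E. (norm (adjoint L e))\<^sup>2 / (ev e - c))"
proof -
  have trace: "(\<Sum>f\<in>Basis. (L f \<bullet> e)\<^sup>2) = (norm (adjoint L e))\<^sup>2" for e
    unfolding parseval_norm[OF is_onb_Basis, of "adjoint L e"]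
    by (intro sum.cong) (auto simp: adjoint_clauses[OF lin] inner_commute)
  have "potential L T c = (\<Sum>f\<in>Basis. \<Sum>e\<in>E. (L f \<bullet> e)\<^sup>2 / (ev e - c))"
    unfolding potential_eq_quadratic[OF lin] by (simp add: quadratic_shifted_inverse[OF c])
  also have "\<dots> = (\<Sum>e\<in>E. (\<Sum>f\<in>Basis. (L f \<bullet> e)\<^sup>2) / (ev e - c))"
    unfolding sum_divide_distrib by (rule sum.swap)
  finally show ?thesis by (simp only: trace)
qed

text \<open>
  The trace may be taken in the basis \<open>v\<close>.  This turns a bound on the potential into a bound on the
  average over the vectors \<open>L (v i)\<close> from which the algorithm selects.
\<close>

lemma potential_eq_sum_basis:
  assumes lin: "linear L" and v: "orthonormal_basis v n" and c: "c \<notin> ev ` E"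
  shows "potential L T c = (\<Sum>i\<in>{1..n}. L (v i) \<bullet> shifted_inverse T c (L (v i)))"
proof -
  have "(\<Sum>i\<in>{1..n}. L (v i) \<bullet> shifted_inverse T c (L (v i)))
      = (\<Sum>i\<in>{1..n}. \<Sum>e\<in>E. (L (v i) \<bullet> e)\<^sup>2 / (ev e - c))"
    by (simp add: quadratic_shifted_inverse[OF c])
  also have "\<dots> = (\<Sum>e\<in>E. (\<Sum>i\<in>{1..n}. (L (v i) \<bullet> e)\<^sup>2) / (ev e - c))"
    unfolding sum_divide_distrib by (rule sum.swap)
  finally show ?thesis by (simp only: sum_inner_onb_image[OF lin v] potential_eq[OF lin c])
qed

text \<open>
  The Sherman--Morrison formula: subtracting the right multiple of \<open>S \<omega>\<close> from \<open>S x\<close>, where \<open>S\<close> is the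
  old resolvent, cancels the contribution of \<open>\<omega> \<omega>\<^sup>T\<close>.
\<close>

lemma shifted_inverse_rank_one_update:
  fixes \<omega> :: 'a
  assumes c: "c \<notin> ev ` E" and q: "1 + \<omega> \<bullet> shifted_inverse T c \<omega> \<noteq> 0"
  shows "shifted_inverse (\<lambda>x. T x + (\<omega> \<bullet> x) *\<^sub>R \<omega>) c x =
    shifted_inverse T c x
      - ((\<omega> \<bullet> shifted_inverse T c x) / (1 + \<omega> \<bullet> shifted_inverse T c \<omega>)) *\<^sub>R shifted_inverse T c \<omega>"
proof -
  let ?S = "shifted_inverse T c"
  define k where "k x = (\<omega> \<bullet> ?S x) / (1 + \<omega> \<bullet> ?S \<omega>)" for x
  have k: "\<omega> \<bullet> ?S x - k x * (\<omega> \<bullet> ?S \<omega>) = k x" for x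
    using q by (simp add: k_def field_simps)
  define R where "R x = ?S x - k x *\<^sub>R ?S \<omega>" for x
  have TS: "T (?S x) = x + c *\<^sub>R ?S x" for x
    using shifted_inverse_right[OF c, of x] by (simp add: algebra_simps)
  have "T (R x) + (\<omega> \<bullet> R x) *\<^sub>R \<omega> - c *\<^sub>R R x = x" for x
  proof -
    have "\<omega> \<bullet> R x = k x" by (simp add: R_def inner_diff_right k)
    then show ?thesis
      by (simp add: R_def linear_diff[OF linear_T] linear_scale[OF linear_T] TS algebra_simps)
  qed
  moreover have "linear (\<lambda>x. T x + (\<omega> \<bullet> x) *\<^sub>R \<omega> - c *\<^sub>R x)"
    by (intro linear_compose_sub linear_compose_add linear_T)
       (simp_all add: linear_iff inner_add_right algebra_simps)
  ultimately have "shifted_inverse (\<lambda>x. T x + (\<omega> \<bullet> x) *\<^sub>R \<omega>) c = R"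
    unfolding shifted_inverse_def by (intro inv_eq_right_inverse)
  then show ?thesis by (simp add: R_def k_def)
qed

text \<open>
  The correction in the Sherman--Morrison formula has rank one, so it changes the trace by a single
  squared norm.
\<close>

lemma potential_rank_one_update:
  fixes \<omega> :: 'a
  assumes lin: "linear L" and c: "c \<notin> ev ` E" and q: "1 + \<omega> \<bullet> shifted_inverse T c \<omega> \<noteq> 0"
  shows "potential L (\<lambda>x. T x + (\<omega> \<bullet> x) *\<^sub>R \<omega>) c =
    potential L T c
      - (norm (adjoint L (shifted_inverse T c \<omega>)))\<^sup>2 / (1 + \<omega> \<bullet> shifted_inverse T c \<omega>)"
proof -
  let ?S = "shifted_inverse T c" and ?d = "1 + \<omega> \<bullet> shifted_inverse T c \<omega>"
  have "L f \<bullet> shifted_inverse (\<lambda>x. T x + (\<omega> \<bullet> x) *\<^sub>R \<omega>) c (L f)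
      = L f \<bullet> ?S (L f) - (f \<bullet> adjoint L (?S \<omega>))\<^sup>2 / ?d" for f
    unfolding shifted_inverse_rank_one_update[OF c q] adjoint_works[OF lin] inner_diff_right
    by (simp add: inner_shifted_inverse_commute[OF c, of \<omega> "L f"] power2_eq_square)
  then show ?thesis
    unfolding potential_eq_quadratic[OF lin] parseval_norm[OF is_onb_Basis, of "adjoint L (?S \<omega>)"]
    by (simp add: sum_subtractf inner_commute sum_divide_distrib)
qed

end

section \<open>Barriers and rank-one updates\<close>

lemma dominated_average:
  fixes f g :: "'i \<Rightarrow> real"
  assumes "finite I" "I \<noteq> {}" "sum f I \<le> sum g I"
  shows "\<exists>i\<in>I. f i \<le> g i"
proof (rule ccontr)
  assume "\<not> ?thesis"
  then have "sum g I < sum f I" using assms by (intro sum_strict_mono) auto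
  with assms(3) show False by simp
qed

context eigenbasis
begin

text \<open>
  The spectrum avoids the interval from just above \<open>0\<close> up to \<open>b\<close>.  The kernel lies below the barrier,
  so \<open>T - b I\<close> is indefinite in general.
\<close>

definition barrier :: "real \<Rightarrow> bool" where
  "barrier b \<longleftrightarrow> 0 < b \<and> (\<forall>e\<in>E. ev e = 0 \<or> b < ev e)"

lemma barrier_iff: "barrier b \<longleftrightarrow> 0 < b \<and> (\<forall>\<mu>\<in>nonzero_eigenvalues T. b < \<mu>)"
  unfolding barrier_def nonzero_eigenvalues_eq by auto

lemma barrier_lower: "barrier b \<Longrightarrow> 0 < c \<Longrightarrow> c \<le> b \<Longrightarrow> barrier c"
  unfolding barrier_def by auto

lemma barrier_not_eigenvalue: "barrier b \<Longrightarrow> b \<notin> ev ` E"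
  unfolding barrier_def by auto

lemma barrier_ev_nonneg: "barrier b \<Longrightarrow> e \<in> E \<Longrightarrow> 0 \<le> ev e"
  unfolding barrier_def by fastforce

text \<open>
  Two barriers are never separated by an eigenvalue, so both factors have the same sign, on the
  kernel as well as on the range.
\<close>

lemma barrier_resolvent_product_pos:
  assumes "barrier b" "0 < c" "c \<le> b" "e \<in> E"
  shows "0 < (ev e - b) * (ev e - c)"
  using assms unfolding barrier_def
  by (cases "ev e = 0") (auto intro: mult_pos_pos mult_neg_neg)

text \<open>
  The resolvent identity, one diagonal entry at a time.
\<close>

lemma resolvent_difference:
  assumes b: "barrier b" and c: "0 < c" "c \<le> b" and e: "e \<in> E"
  shows "y / (ev e - b) - y / (ev e - c) = y * ((b - c) / ((ev e - b) * (ev e - c)))"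
proof -
  have "ev e - b \<noteq> 0" "ev e - c \<noteq> 0"
    using barrier_resolvent_product_pos[OF assms] by auto
  then have "y / (ev e - b) - y / (ev e - c)
      = (y * (ev e - c) - y * (ev e - b)) / ((ev e - b) * (ev e - c))"
    by (rule diff_frac_eq)
  also have "y * (ev e - c) - y * (ev e - b) = y * (b - c)" by (simp add: algebra_simps)
  finally show ?thesis by simp
qed

text \<open>
  By the resolvent identity, the two forms differ by one with diagonal entries
  \<open>(b - c) / ((ev e - b) (ev e - c)) > 0\<close>.
\<close>

lemma quadratic_shifted_inverse_strict_mono:
  assumes b: "barrier b" and c: "0 < c" "c < b" and x: "x \<noteq> 0"
  shows "x \<bullet> shifted_inverse T c x < x \<bullet> shifted_inverse T b x"
proof -
  have nc: "barrier c" using barrier_lower[OF b] c by simp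
  note diff = resolvent_difference[OF b c(1) less_imp_le[OF c(2)]]
  have pos: "0 < (b - c) / ((ev e - b) * (ev e - c))" if "e \<in> E" for e
    using barrier_resolvent_product_pos[OF b c(1) less_imp_le[OF c(2)] that] c(2) by simp
  obtain e where e: "e \<in> E" "x \<bullet> e \<noteq> 0"
    using onb_eqI[OF onb, of x 0] x by auto
  show ?thesis
    unfolding quadratic_shifted_inverse[OF barrier_not_eigenvalue[OF b]]
      quadratic_shifted_inverse[OF barrier_not_eigenvalue[OF nc]]
  proof (rule sum_strict_mono_ex1[OF finite_E])
    show "\<forall>e\<in>E. (x \<bullet> e)\<^sup>2 / (ev e - c) \<le> (x \<bullet> e)\<^sup>2 / (ev e - b)"
    proof
      fix e assume e: "e \<in> E"
      have "0 \<le> (x \<bullet> e)\<^sup>2 * ((b - c) / ((ev e - b) * (ev e - c)))"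
        using pos[OF e] by (intro mult_nonneg_nonneg) auto
      then show "(x \<bullet> e)\<^sup>2 / (ev e - c) \<le> (x \<bullet> e)\<^sup>2 / (ev e - b)"
        unfolding diff[OF e, symmetric] by simp
    qed
    have "0 < (x \<bullet> e)\<^sup>2 * ((b - c) / ((ev e - b) * (ev e - c)))"
      using pos[OF e(1)] e(2) by (intro mult_pos_pos) auto
    then show "\<exists>e\<in>E. (x \<bullet> e)\<^sup>2 / (ev e - c) < (x \<bullet> e)\<^sup>2 / (ev e - b)"
      unfolding diff[OF e(1), symmetric] using e(1) by (intro bexI[of _ e]) auto
  qed
qed

text \<open>
  The resolvent is negative only on the kernel of \<open>T\<close>.
\<close>

lemma quadratic_shifted_inverse_nonneg:
  assumes b: "barrier b" and x: "\<And>e. e \<in> E \<Longrightarrow> ev e = 0 \<Longrightarrow> x \<bullet> e = 0"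
  shows "0 \<le> x \<bullet> shifted_inverse T b x"
  unfolding quadratic_shifted_inverse[OF barrier_not_eigenvalue[OF b]]
proof (rule sum_nonneg)
  fix e assume e: "e \<in> E"
  show "0 \<le> (x \<bullet> e)\<^sup>2 / (ev e - b)"
    using b x[OF e] e unfolding barrier_def by (cases "ev e = 0") auto
qed

text \<open>
  An eigenvector \<open>x\<close> of the update satisfies \<open>x = - (\<omega> \<bullet> x) (T - \<mu> I)\<^sup>-\<^sup>1 \<omega>\<close>; take the inner product
  with \<open>\<omega>\<close> and cancel \<open>\<omega> \<bullet> x\<close>.
\<close>

lemma secular_equation:
  fixes \<omega> :: 'a
  assumes \<mu>: "\<mu> \<notin> ev ` E" and x: "x \<noteq> 0" "T x + (\<omega> \<bullet> x) *\<^sub>R \<omega> = \<mu> *\<^sub>R x"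
  shows "\<omega> \<bullet> shifted_inverse T \<mu> \<omega> = - 1"
proof -
  let ?k = "\<omega> \<bullet> x"
  have xe: "x \<bullet> e = - ?k * ((\<omega> \<bullet> e) / (ev e - \<mu>))" if "e \<in> E" for e
  proof -
    have "(T x + ?k *\<^sub>R \<omega>) \<bullet> e = (\<mu> *\<^sub>R x) \<bullet> e" by (simp only: x(2))
    then have "(ev e - \<mu>) * (x \<bullet> e) = - ?k * (\<omega> \<bullet> e)"
      by (simp add: inner_add_left T_inner_eigenvector[OF that] algebra_simps)
    moreover have "ev e - \<mu> \<noteq> 0" using \<mu> that by auto
    ultimately show ?thesis by (simp add: field_simps)
  qed
  have "x = - ?k *\<^sub>R shifted_inverse T \<mu> \<omega>"
    by (rule onb_eqI[OF onb]) (simp add: xe shifted_inverse_inner[OF \<mu>])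
  then have "?k = - ?k * (\<omega> \<bullet> shifted_inverse T \<mu> \<omega>)" "?k \<noteq> 0"
    using x(1) by (metis inner_scaleR_right, auto)
  then have "?k * (1 + \<omega> \<bullet> shifted_inverse T \<mu> \<omega>) = 0" by (simp add: algebra_simps)
  then show ?thesis using \<open>?k \<noteq> 0\<close> by simp
qed

text \<open>
  The form \<open>\<omega> \<bullet> (T - \<mu> I)\<^sup>-\<^sup>1 \<omega>\<close> increases strictly in \<open>\<mu>\<close> on \<open>(0, b]\<close>.  Being at most \<open>-1\<close> at \<open>b\<close>, it is
  below \<open>-1\<close> before \<open>b\<close>, where the secular equation therefore has no solution.
\<close>

lemma update_eigenvalue_ge:
  fixes \<omega> :: 'a
  assumes b: "barrier b" and \<omega>: "\<omega> \<bullet> shifted_inverse T b \<omega> \<le> - 1"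
    and \<mu>: "\<mu> \<in> nonzero_eigenvalues (\<lambda>x. T x + (\<omega> \<bullet> x) *\<^sub>R \<omega>)"
  shows "b \<le> \<mu>"
proof (rule ccontr)
  assume "\<not> b \<le> \<mu>"
  then have "\<mu> < b" by simp
  obtain x where x: "x \<noteq> 0" "T x + (\<omega> \<bullet> x) *\<^sub>R \<omega> = \<mu> *\<^sub>R x" and "\<mu> \<noteq> 0"
    using \<mu> unfolding nonzero_eigenvalues_def by blast
  have "\<mu> * (x \<bullet> x) = x \<bullet> (T x + (\<omega> \<bullet> x) *\<^sub>R \<omega>)" by (simp add: x(2))
  also have "\<dots> = (\<Sum>e\<in>E. ev e * (x \<bullet> e)\<^sup>2) + (\<omega> \<bullet> x)\<^sup>2"
    by (simp add: inner_add_right quadratic_form power2_eq_square inner_commute)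
  also have "\<dots> \<ge> 0"
    using barrier_ev_nonneg[OF b] by (intro add_nonneg_nonneg sum_nonneg mult_nonneg_nonneg) auto
  finally have "0 \<le> \<mu> * (x \<bullet> x)" .
  moreover have "0 < x \<bullet> x" using x(1) by simp
  ultimately have "0 \<le> \<mu>" by (simp add: zero_le_mult_iff)
  then have "0 < \<mu>" using \<open>\<mu> \<noteq> 0\<close> by simp
  have "barrier \<mu>" using barrier_lower[OF b \<open>0 < \<mu>\<close>] \<open>\<mu> < b\<close> by simp
  then have "\<omega> \<bullet> shifted_inverse T \<mu> \<omega> = - 1"
    using secular_equation[OF barrier_not_eigenvalue x] by blast
  moreover have "\<omega> \<noteq> 0"
    using \<omega> by auto
  then have "\<omega> \<bullet> shifted_inverse T \<mu> \<omega> < - 1"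
    using quadratic_shifted_inverse_strict_mono[OF b \<open>0 < \<mu>\<close> \<open>\<mu> < b\<close>] \<omega> by fastforce
  ultimately show False by simp
qed

text \<open>
  If the form is below \<open>-1\<close> at \<open>b\<close>, then \<open>b\<close> itself fails the secular equation.
\<close>

lemma update_eigenvalue_gt:
  fixes \<omega> :: 'a
  assumes b: "barrier b" and \<omega>: "\<omega> \<bullet> shifted_inverse T b \<omega> < - 1"
    and \<mu>: "\<mu> \<in> nonzero_eigenvalues (\<lambda>x. T x + (\<omega> \<bullet> x) *\<^sub>R \<omega>)"
  shows "b < \<mu>"
proof -
  have "\<mu> \<noteq> b"
  proof
    assume "\<mu> = b"
    then obtain x where "x \<noteq> 0" "T x + (\<omega> \<bullet> x) *\<^sub>R \<omega> = b *\<^sub>R x"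
      using \<mu> unfolding nonzero_eigenvalues_def by blast
    from secular_equation[OF barrier_not_eigenvalue[OF b] this] \<omega> show False by simp
  qed
  with update_eigenvalue_ge[OF b _ \<mu>] \<omega> show ?thesis by simp
qed

text \<open>
  The average of the forms over the \<open>n\<close> vectors is at most \<open>-1\<close>.
\<close>

lemma exists_vector_below:
  assumes lin: "linear L" and v: "orthonormal_basis v n" and n: "0 < n" and b: "barrier b"
    and pot: "potential L T b \<le> - real n"
  shows "\<exists>i\<in>{1..n}. L (v i) \<bullet> shifted_inverse T b (L (v i)) \<le> - 1"
proof (rule dominated_average)
  show "(\<Sum>i\<in>{1..n}. L (v i) \<bullet> shifted_inverse T b (L (v i))) \<le> (\<Sum>i\<in>{1..n}. - 1)"
    using pot potential_eq_sum_basis[OF lin v barrier_not_eigenvalue[OF b]] by simp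
qed (use n in auto)

text \<open>
  Let \<open>c = b - \<delta>\<close>, let \<open>D\<close> be the amount by which the potential drops when the barrier moves from \<open>b\<close>
  to \<open>c\<close>, and let \<open>S\<close> be the resolvent at \<open>c\<close>.  By the Sherman--Morrison formula, if
  \<open>\<omega> \<bullet> S \<omega> < - 1\<close>, then the update by \<open>\<omega>\<close> gives back at most \<open>D\<close> precisely when
  \<open>\<parallel>L\<^sup>T S \<omega>\<parallel>\<^sup>2 \<le> D (- 1 - \<omega> \<bullet> S \<omega>)\<close>.  The proof finds \<open>\<omega>\<close> with the stronger property
  \<open>\<parallel>L\<^sup>T S \<omega>\<parallel>\<^sup>2 \<le> D (- 1 - \<omega> \<bullet> (T - b I)\<^sup>-\<^sup>1 \<omega>)\<close>, which refers to the old barrier.  As the left-hand side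
  is nonnegative and \<open>D > 0\<close>, it also forces the form at \<open>b\<close> to be at most \<open>-1\<close>; this is what
  makes \<open>b\<close>, and not just \<open>c\<close>, a lower bound for the nonzero eigenvalues after the update.

  Such a vector exists because the inequality holds on average.  The left-hand sides add up to at
  most \<open>\<parallel>L\<parallel>\<^sup>2\<close> times the sum of \<open>\<parallel>L\<^sup>T e\<parallel>\<^sup>2 / (ev e - c)\<^sup>2\<close>, the right-hand sides to at least
  \<open>2 \<parallel>L\<parallel>\<^sup>2 D / \<delta>\<close>, and \<open>D / \<delta>\<close> is the sum of \<open>\<parallel>L\<^sup>T e\<parallel>\<^sup>2 / ((ev e - b) (ev e - c))\<close>.  So it is enough that
  \<open>(ev e - b) (ev e - c) \<le> 2 (ev e - c)\<^sup>2\<close>.  On the range this holds without the factor \<open>2\<close>; on the kernel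
  it says \<open>b \<le> 2 c\<close>, which follows from \<open>\<delta> < b - \<delta>\<close>.
\<close>

lemma exists_selection:
  fixes L :: "'a \<Rightarrow> 'a"
  assumes lin: "linear L" and v: "orthonormal_basis v n" and n: "0 < n"
    and nonzero: "\<And>i. i \<in> {1..n} \<Longrightarrow> L (v i) \<noteq> 0"
    and b: "barrier b" and \<delta>: "0 < \<delta>" "\<delta> < b - \<delta>"
    and pot: "potential L T b \<le> - real n - 2 * (onorm L)\<^sup>2 / \<delta>"
  shows "\<exists>\<omega>\<in>(\<lambda>i. L (v i)) ` {1..n}.
    \<omega> \<bullet> shifted_inverse T b \<omega> \<le> - 1 \<and>
    \<omega> \<bullet> shifted_inverse T (b - \<delta>) \<omega> < - 1 \<and>
    potential L (\<lambda>x. T x + (\<omega> \<bullet> x) *\<^sub>R \<omega>) (b - \<delta>) \<le> potential L T b"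
proof -
  define c where "c = b - \<delta>"
  have c: "0 < c" "c < b" "c \<le> b" "b - c = \<delta>" "b < 2 * c" using \<delta> unfolding c_def by auto
  have bc: "barrier c" by (rule barrier_lower[OF b c(1,3)])
  note nb = barrier_not_eigenvalue[OF b] and nc = barrier_not_eigenvalue[OF bc]
  define \<omega> where "\<omega> i = L (v i)" for i
  let ?q = "\<lambda>s i. \<omega> i \<bullet> shifted_inverse T s (\<omega> i)"
  define D where "D = potential L T b - potential L T c"
  have strict: "?q c i < ?q b i" if "i \<in> {1..n}" for i
    using quadratic_shifted_inverse_strict_mono[OF b c(1,2)] nonzero[OF that] by (simp add: \<omega>_def)
  have D_pos: "0 < D"
  proof -
    have "(\<Sum>i\<in>{1..n}. ?q c i) < (\<Sum>i\<in>{1..n}. ?q b i)"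
      using n strict by (intro sum_strict_mono) auto
    then show ?thesis
      by (simp add: D_def potential_eq_sum_basis[OF lin v nb] potential_eq_sum_basis[OF lin v nc] \<omega>_def)
  qed
  define g where "g e = (norm (adjoint L e))\<^sup>2" for e
  have D_eq: "D = (\<Sum>e\<in>E. g e * (\<delta> / ((ev e - b) * (ev e - c))))"
    unfolding D_def potential_eq[OF lin nb] potential_eq[OF lin nc] sum_subtractf[symmetric] g_def
    by (intro sum.cong refl) (simp only: resolvent_difference[OF b c(1,3)] c(4))
  have "(\<Sum>i\<in>{1..n}. (norm (shifted_inverse T c (\<omega> i)))\<^sup>2)
      = (\<Sum>i\<in>{1..n}. \<Sum>e\<in>E. (L (v i) \<bullet> e)\<^sup>2 / (ev e - c)\<^sup>2)"
    unfolding parseval_norm[OF onb] \<omega>_def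
    by (intro sum.cong refl) (simp add: shifted_inverse_inner[OF nc] power_divide)
  also have "\<dots> = (\<Sum>e\<in>E. (\<Sum>i\<in>{1..n}. (L (v i) \<bullet> e)\<^sup>2) / (ev e - c)\<^sup>2)"
    unfolding sum_divide_distrib by (rule sum.swap)
  also have "\<dots> = (\<Sum>e\<in>E. g e / (ev e - c)\<^sup>2)"
    unfolding sum_inner_onb_image[OF lin v] g_def ..
  also have "\<dots> \<le> (\<Sum>e\<in>E. g e * (2 / ((ev e - b) * (ev e - c))))"
  proof (rule sum_mono)
    fix e assume e: "e \<in> E"
    have p: "0 < (ev e - b) * (ev e - c)" by (rule barrier_resolvent_product_pos[OF b c(1,3) e])
    have "(ev e - b) * (ev e - c) \<le> 2 * (ev e - c)\<^sup>2"
    proof (cases "ev e = 0")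
      case True
      have "b * c \<le> 2 * c * c" using c by (intro mult_right_mono) auto
      then show ?thesis using True by (simp add: power2_eq_square)
    next
      case False
      then have "b < ev e" using b e by (auto simp: barrier_def)
      then have "(ev e - b) * (ev e - c) \<le> (ev e - c) * (ev e - c)"
        using c by (intro mult_right_mono) auto
      then show ?thesis using zero_le_power2[of "ev e - c"] by (simp only: power2_eq_square)
    qed
    moreover have "0 < (ev e - c)\<^sup>2" using p by auto
    ultimately have "1 / (ev e - c)\<^sup>2 \<le> 2 / ((ev e - b) * (ev e - c))"
      using p by (simp add: divide_simps)
    then have "g e * (1 / (ev e - c)\<^sup>2) \<le> g e * (2 / ((ev e - b) * (ev e - c)))"
      by (rule mult_left_mono) (simp add: g_def)
    then show "g e / (ev e - c)\<^sup>2 \<le> g e * (2 / ((ev e - b) * (ev e - c)))" by simp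
  qed
  also have "\<dots> = 2 / \<delta> * D"
    unfolding D_eq sum_distrib_left using \<delta>(1) by (intro sum.cong) auto
  finally have resolvent_norms: "(\<Sum>i\<in>{1..n}. (norm (shifted_inverse T c (\<omega> i)))\<^sup>2) \<le> 2 / \<delta> * D" .
  define f where "f i = (norm (adjoint L (shifted_inverse T c (\<omega> i))))\<^sup>2" for i
  have "\<exists>i\<in>{1..n}. f i \<le> D * (- 1 - ?q b i)"
  proof (rule dominated_average)
    have "(\<Sum>i\<in>{1..n}. f i) \<le> (\<Sum>i\<in>{1..n}. (onorm L)\<^sup>2 * (norm (shifted_inverse T c (\<omega> i)))\<^sup>2)"
      unfolding f_def power_mult_distrib[symmetric]
      by (intro sum_mono power_mono norm_adjoint_le lin) simp
    also have "\<dots> \<le> (onorm L)\<^sup>2 * (2 / \<delta> * D)"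
      unfolding sum_distrib_left[symmetric] by (intro mult_left_mono resolvent_norms) simp
    also have "\<dots> = D * (2 * (onorm L)\<^sup>2 / \<delta>)" by simp
    also have "\<dots> \<le> D * (- real n - potential L T b)"
      using pot D_pos by (intro mult_left_mono) auto
    also have "\<dots> = (\<Sum>i\<in>{1..n}. D * (- 1 - ?q b i))"
      unfolding sum_distrib_left[symmetric] sum_subtractf potential_eq_sum_basis[OF lin v nb] \<omega>_def
      by simp
    finally show "(\<Sum>i\<in>{1..n}. f i) \<le> (\<Sum>i\<in>{1..n}. D * (- 1 - ?q b i))" .
  qed (use n in auto)
  then obtain i where i: "i \<in> {1..n}" "f i \<le> D * (- 1 - ?q b i)" by blast
  \<comment> \<open>Strict positivity of \<open>D\<close> allows the sign of the other factor to be read off.\<close>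
  have "0 \<le> D * (- 1 - ?q b i)" using i(2) by (rule order_trans[rotated]) (simp add: f_def)
  then have qb: "?q b i \<le> - 1" using D_pos by (simp add: zero_le_mult_iff)
  then have qc: "?q c i < - 1" using strict[OF i(1)] by simp
  have "f i \<le> D * (- 1 - ?q c i)"
    using i(2) D_pos strict[OF i(1)] by (elim order_trans, intro mult_left_mono) auto
  then have "- (f i / (1 + ?q c i)) \<le> D"
    using qc by (simp add: field_simps)
  then have "potential L (\<lambda>x. T x + (\<omega> i \<bullet> x) *\<^sub>R \<omega> i) c \<le> potential L T b"
    using qc by (subst potential_rank_one_update[OF lin nc]) (auto simp: f_def D_def)
  with i(1) qb qc show ?thesis
    by (intro bexI[of _ "\<omega> i"]) (auto simp: c_def \<omega>_def)
qed

end

section \<open>Frame operators and Riesz bounds\<close>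

lemma linear_frame_op: "linear (frame_op W)"
  unfolding frame_op_def
  by (intro linearI)
     (simp_all add: inner_add_right scaleR_add_left sum.distrib scaleR_sum_right)

lemma frame_op_symmetric: "frame_op W x \<bullet> y = x \<bullet> frame_op W y"
  unfolding frame_op_def
  by (simp add: inner_sum_left inner_sum_right inner_commute mult.commute)

lemma frame_op_insert:
  assumes "finite W" "\<omega> \<notin> W"
  shows "frame_op (insert \<omega> W) = (\<lambda>x. frame_op W x + (\<omega> \<bullet> x) *\<^sub>R \<omega>)"
  using assms by (auto simp: frame_op_def fun_eq_iff add.commute)

lemma frame_op_quadratic: "x \<bullet> frame_op W x = (\<Sum>w\<in>W. (w \<bullet> x)\<^sup>2)"
  unfolding frame_op_def
  by (simp add: inner_sum_right inner_commute power2_eq_square)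

lemma frame_op_in_span: "frame_op W x \<in> span W"
  unfolding frame_op_def by (intro span_sum span_scale span_base)

locale frame_eigenbasis = eigenbasis "frame_op W" E ev
  for W :: "'a::euclidean_space set" and E ev +
  assumes indep: "independent W"
begin

lemma finite_W: "finite W"
  using indep by (rule independent_imp_finite)

text \<open>
  \<open>e \<bullet> A e\<close> is the sum of the \<open>(w \<bullet> e)\<^sup>2\<close>, so a vector in the kernel of the frame operator is orthogonal to
  all of \<open>W\<close>.
\<close>

lemma span_orthogonal_kernel:
  assumes "x \<in> span W" "e \<in> E" "ev e = 0"
  shows "x \<bullet> e = 0"
proof -
  have "(\<Sum>w\<in>W. (w \<bullet> e)\<^sup>2) = 0"
    using eigenvector[OF assms(2)] assms(3) by (simp flip: frame_op_quadratic)
  then have "orthogonal e w" if "w \<in> W" for w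
    using that finite_W by (simp add: sum_nonneg_eq_0_iff orthogonal_def inner_commute[of e])
  then have "orthogonal e x" using assms(1) by (rule orthogonal_to_span[rotated])
  then show ?thesis by (simp add: orthogonal_def inner_commute)
qed

lemma span_range_eigenvectors: "span {e \<in> E. ev e \<noteq> 0} = span W"
proof (rule antisym)
  have "e \<in> span W" if "e \<in> E" "ev e \<noteq> 0" for e
  proof -
    have "e = inverse (ev e) *\<^sub>R frame_op W e" using that by (simp add: eigenvector)
    then show ?thesis by (metis frame_op_in_span span_scale)
  qed
  then show "span {e \<in> E. ev e \<noteq> 0} \<subseteq> span W" by (intro span_minimal) auto
  show "span W \<subseteq> span {e \<in> E. ev e \<noteq> 0}"
  proof
    fix x assume x: "x \<in> span W"
    have "x = (\<Sum>e\<in>{e \<in> E. ev e \<noteq> 0}. (x \<bullet> e) *\<^sub>R e)"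
      by (subst is_onb_expand[OF onb, of x, symmetric], intro sum.mono_neutral_right)
         (auto simp: finite_E span_orthogonal_kernel[OF x])
    also have "\<dots> \<in> span {e \<in> E. ev e \<noteq> 0}"
      by (intro span_sum span_scale span_base)
    finally show "x \<in> span {e \<in> E. ev e \<noteq> 0}" .
  qed
qed

text \<open>
  The rank of the frame operator is the dimension of the span of \<open>W\<close>.
\<close>

lemma num_nonzero_eigenvalues_card: "num_nonzero_eigenvalues (frame_op W) = card W"
proof -
  have "card {e \<in> E. ev e \<noteq> 0} = dim (span {e \<in> E. ev e \<noteq> 0})"
    by (simp add: dim_eq_card_independent is_onb_independent[OF onb])
  also have "\<dots> = card W"
    by (simp add: span_range_eigenvectors dim_eq_card_independent indep)
  finally show ?thesis by (simp add: num_nonzero_eigenvalues_eq)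
qed

text \<open>
  The Gram matrix of \<open>W\<close> and the frame operator \<open>A\<close> have the same nonzero spectrum.  Concretely, the
  combination \<open>x\<close> lies in the range of \<open>A\<close>, say \<open>x = A y\<close>, and independence forces the coefficients to be
  \<open>a w = w \<bullet> y\<close>.  Hence their squares add up to \<open>y \<bullet> A y\<close>, which is compared with \<open>\<parallel>A y\<parallel>\<^sup>2\<close> in the
  eigenbasis.
\<close>

lemma eigenvalue_bound_imp_riesz:
  assumes c: "0 < c" "\<And>\<mu>. \<mu> \<in> nonzero_eigenvalues (frame_op W) \<Longrightarrow> c \<le> \<mu>"
  shows "lower_riesz_bound W c"
  unfolding lower_riesz_bound_def
proof (intro conjI allI ballI)
  fix a :: "'a \<Rightarrow> real"
  define x where "x = (\<Sum>w\<in>W. a w *\<^sub>R w)"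
  have x: "x \<in> span W" unfolding x_def by (intro span_sum span_scale span_base)
  \<comment> \<open>Division by zero makes the components of \<open>y\<close> along the kernel vanish.\<close>
  define y where "y = (\<Sum>e\<in>E. ((x \<bullet> e) / ev e) *\<^sub>R e)"
  have y: "y \<bullet> e = (x \<bullet> e) / ev e" if "e \<in> E" for e
    unfolding y_def by (rule onb_sum_inner[OF onb that])
  have "frame_op W y = x"
  proof (rule onb_eqI[OF onb])
    fix e assume "e \<in> E"
    then show "frame_op W y \<bullet> e = x \<bullet> e"
      using span_orthogonal_kernel[OF x] by (cases "ev e = 0") (auto simp: T_inner_eigenvector y)
  qed
  then have "(\<Sum>w\<in>W. (a w - w \<bullet> y) *\<^sub>R w) = 0"
    by (simp add: frame_op_def x_def scaleR_diff_left sum_subtractf)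
  then have a: "a w = w \<bullet> y" if "w \<in> W" for w
    using independentD[OF indep finite_W order_refl, of "\<lambda>w. a w - w \<bullet> y" w] that by simp
  have "c * (\<Sum>w\<in>W. \<bar>a w\<bar>\<^sup>2) = c * (\<Sum>w\<in>W. (w \<bullet> y)\<^sup>2)"
    by (simp add: a)
  also have "\<dots> = c * (\<Sum>e\<in>E. (x \<bullet> e)\<^sup>2 / ev e)"
    unfolding frame_op_quadratic[symmetric] \<open>frame_op W y = x\<close>
    by (subst parseval_inner[OF onb]) (simp add: y power2_eq_square)
  also have "\<dots> \<le> (\<Sum>e\<in>E. (x \<bullet> e)\<^sup>2)"
    unfolding sum_distrib_left
  proof (rule sum_mono)
    fix e assume e: "e \<in> E"
    show "c * ((x \<bullet> e)\<^sup>2 / ev e) \<le> (x \<bullet> e)\<^sup>2"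
    proof (cases "ev e = 0")
      case False
      then have "c \<le> ev e" using c(2) e by (simp add: nonzero_eigenvalues_eq)
      then have "c * (x \<bullet> e)\<^sup>2 \<le> ev e * (x \<bullet> e)\<^sup>2" by (rule mult_right_mono) simp
      then show ?thesis using c(1) \<open>c \<le> ev e\<close> by (simp add: divide_le_eq mult.commute)
    qed simp
  qed
  also have "\<dots> = (norm (\<Sum>w\<in>W. a w *\<^sub>R w))\<^sup>2"
    by (simp only: parseval_norm[OF onb] x_def)
  finally show "c * (\<Sum>w\<in>W. \<bar>a w\<bar>\<^sup>2) \<le> (norm (\<Sum>w\<in>W. a w *\<^sub>R w))\<^sup>2" .
qed (rule c(2))

text \<open>
  On the span of \<open>W\<close> the resolvent is positive.
\<close>

lemma vector_below_notin_span:
  assumes "barrier b" "\<omega> \<bullet> shifted_inverse (frame_op W) b \<omega> \<le> - 1"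
  shows "\<omega> \<notin> span W"
proof
  assume "\<omega> \<in> span W"
  then have "0 \<le> \<omega> \<bullet> shifted_inverse (frame_op W) b \<omega>"
    by (intro quadratic_shifted_inverse_nonneg assms(1) span_orthogonal_kernel)
  with assms(2) show False by simp
qed

end

lemma independent_frame_eigenbasis:
  assumes "independent W"
  obtains E ev where "frame_eigenbasis W E ev"
proof -
  obtain E ev where "eigenbasis (frame_op W) E ev"
    using spectral_theorem[OF linear_frame_op frame_op_symmetric] by blast
  with assms show ?thesis
    by (intro that) (simp add: frame_eigenbasis_def frame_eigenbasis_axioms_def)
qed

lemma lower_riesz_bound_if_independent:
  assumes W: "independent W"
    and c: "0 < c" "\<And>\<mu>. \<mu> \<in> nonzero_eigenvalues (frame_op W) \<Longrightarrow> c \<le> \<mu>"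
  shows "lower_riesz_bound W c"
proof -
  obtain E ev where "frame_eigenbasis W E ev"
    using independent_frame_eigenbasis[OF W] .
  from frame_eigenbasis.eigenvalue_bound_imp_riesz[OF this c] show ?thesis .
qed

lemma lower_riesz_bound_mono:
  assumes "lower_riesz_bound W c" "c' \<le> c"
  shows "lower_riesz_bound W c'"
  unfolding lower_riesz_bound_def
proof (intro conjI ballI allI)
  show "c' \<le> \<mu>" if "\<mu> \<in> nonzero_eigenvalues (frame_op W)" for \<mu>
    using assms that unfolding lower_riesz_bound_def by force
  fix a :: "'a \<Rightarrow> real"
  have "c' * (\<Sum>w\<in>W. \<bar>a w\<bar>\<^sup>2) \<le> c * (\<Sum>w\<in>W. \<bar>a w\<bar>\<^sup>2)"
    using assms(2) by (intro mult_right_mono sum_nonneg) auto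
  also have "\<dots> \<le> (norm (\<Sum>w\<in>W. a w *\<^sub>R w))\<^sup>2"
    using assms(1) unfolding lower_riesz_bound_def by blast
  finally show "c' * (\<Sum>w\<in>W. \<bar>a w\<bar>\<^sup>2) \<le> (norm (\<Sum>w\<in>W. a w *\<^sub>R w))\<^sup>2" .
qed

text \<open>
  The spectral part of the invariant of the algorithm, free of any choice of an eigenbasis.
\<close>

definition well_separated :: "'a::euclidean_space set \<Rightarrow> real \<Rightarrow> bool" where
  "well_separated W b \<longleftrightarrow> independent W \<and> 0 < b \<and> (\<forall>\<mu>\<in>nonzero_eigenvalues (frame_op W). b < \<mu>)"

lemma (in frame_eigenbasis) barrier_iff_well_separated: "barrier b \<longleftrightarrow> well_separated W b"
  by (simp add: barrier_iff well_separated_def indep)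

lemma well_separated_eigenbasis:
  assumes "well_separated W b"
  obtains E ev where "frame_eigenbasis W E ev" "eigenbasis.barrier E ev b"
proof -
  obtain E ev where E: "frame_eigenbasis W E ev"
    using assms independent_frame_eigenbasis unfolding well_separated_def by blast
  then show ?thesis
    using that assms frame_eigenbasis.barrier_iff_well_separated by blast
qed

lemma well_separated_lower:
  "well_separated W b \<Longrightarrow> 0 < c \<Longrightarrow> c \<le> b \<Longrightarrow> well_separated W c"
  unfolding well_separated_def by auto

lemma well_separated_insert:
  assumes W: "well_separated W b" and \<omega>: "\<omega> \<bullet> shifted_inverse (frame_op W) b \<omega> < - 1"
  shows "\<omega> \<notin> W" and "well_separated (insert \<omega> W) b"
proof -
  obtain E ev where E: "frame_eigenbasis W E ev" "eigenbasis.barrier E ev b"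
    using well_separated_eigenbasis[OF W] .
  interpret frame_eigenbasis W E ev by (rule E(1))
  have "\<omega> \<notin> span W" using vector_below_notin_span[OF E(2)] \<omega> by simp
  then show "\<omega> \<notin> W" using span_base by blast
  then have "b < \<mu>" if "\<mu> \<in> nonzero_eigenvalues (frame_op (insert \<omega> W))" for \<mu>
    using update_eigenvalue_gt[OF E(2) \<omega>] that by (simp add: frame_op_insert finite_W)
  then show "well_separated (insert \<omega> W) b"
    using W indep \<open>\<omega> \<notin> span W\<close> by (simp add: well_separated_def independent_insert)
qed

text \<open>
  The version for the old barrier: the non-strict hypothesis still gives a Riesz bound.
\<close>

lemma riesz_bound_insert:
  assumes W: "well_separated W b" and \<omega>: "\<omega> \<bullet> shifted_inverse (frame_op W) b \<omega> \<le> - 1"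
  shows "\<omega> \<notin> W" and "lower_riesz_bound (insert \<omega> W) b"
proof -
  obtain E ev where E: "frame_eigenbasis W E ev" "eigenbasis.barrier E ev b"
    using well_separated_eigenbasis[OF W] .
  interpret frame_eigenbasis W E ev by (rule E(1))
  have "\<omega> \<notin> span W" by (rule vector_below_notin_span[OF E(2) \<omega>])
  then show "\<omega> \<notin> W" using span_base by blast
  then have "b \<le> \<mu>" if "\<mu> \<in> nonzero_eigenvalues (frame_op (insert \<omega> W))" for \<mu>
    using update_eigenvalue_ge[OF E(2) \<omega>] that by (simp add: frame_op_insert finite_W)
  then show "lower_riesz_bound (insert \<omega> W) b"
    using W indep \<open>\<omega> \<notin> span W\<close>
    by (intro lower_riesz_bound_if_independent) (auto simp: well_separated_def independent_insert)
qed

lemma eigenbasis_frame_op_empty: "frame_eigenbasis {} Basis (\<lambda>_. 0)"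
  by (simp add: frame_eigenbasis_def frame_eigenbasis_axioms_def eigenbasis_def
      linear_frame_op is_onb_Basis frame_op_def independent_empty)

section \<open>The Spielman-Srivastava iteration\<close>

locale restricted_invertibility =
  fixes L :: "'a::euclidean_space \<Rightarrow> 'a" and v :: "nat \<Rightarrow> 'a" and n :: nat and \<epsilon> :: real
  assumes basis: "orthonormal_basis v n"
    and lin: "linear L"
    and unit: "\<forall>i\<in>{1..n}. norm (L (v i)) = 1"
    and eps: "0 < \<epsilon>" "\<epsilon> < 1 / 2"
begin

abbreviation \<delta> :: real where "\<delta> \<equiv> ss_delta L n \<epsilon>"

lemma n_pos: "0 < n"
proof (rule ccontr)
  assume "\<not> 0 < n"
  then have "(UNIV :: 'a set) = {0}"
    using basis by (simp add: orthonormal_basis_def)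
  then show False using nonzero_Basis SOME_Basis by blast
qed

lemma onorm_pos: "0 < onorm L"
proof -
  have 1: "1 \<in> {1..n}" using n_pos by simp
  then have "norm (v 1) = 1"
    using basis by (simp add: orthonormal_basis_def norm_eq_1)
  then have "1 \<le> onorm L"
    using onorm[of L "v 1"] lin unit 1 by (simp add: linear_conv_bounded_linear)
  then show ?thesis by simp
qed

lemma delta_eq: "\<delta> = (1 - 2 * \<epsilon>) * ((onorm L)\<^sup>2 / (\<epsilon> * real n))"
  by (simp add: ss_delta_def)

lemma delta_pos: "0 < \<delta>"
  using eps n_pos onorm_pos by (simp add: ss_delta_def)

text \<open>
  With this \<open>\<delta>\<close> the threshold that the algorithm imposes on the potential is exactly its value at the
  start.
\<close>

lemma initial_potential_bound: "- real n - 2 * (onorm L)\<^sup>2 / \<delta> = - (real n / (1 - 2 * \<epsilon>))"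
proof -
  have "2 * (onorm L)\<^sup>2 / \<delta> = 2 * (\<epsilon> * real n) / (1 - 2 * \<epsilon>)"
    using onorm_pos n_pos eps by (simp add: ss_delta_def field_simps)
  moreover have "real n = (1 - 2 * \<epsilon>) * real n / (1 - 2 * \<epsilon>)" using eps by simp
  ultimately have "- real n - 2 * (onorm L)\<^sup>2 / \<delta>
      = - ((1 - 2 * \<epsilon>) * real n / (1 - 2 * \<epsilon>) + 2 * (\<epsilon> * real n) / (1 - 2 * \<epsilon>))"
    by linarith
  also have "\<dots> = - (((1 - 2 * \<epsilon>) * real n + 2 * (\<epsilon> * real n)) / (1 - 2 * \<epsilon>))"
    by (simp only: add_divide_distrib)
  also have "(1 - 2 * \<epsilon>) * real n + 2 * (\<epsilon> * real n) = real n" by (simp add: algebra_simps)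
  finally show ?thesis .
qed

lemma initial_potential: "potential L (frame_op {}) (1 - 2 * \<epsilon>) = - (real n / (1 - 2 * \<epsilon>))"
proof -
  interpret frame_eigenbasis "{}" Basis "\<lambda>_. 0" by (rule eigenbasis_frame_op_empty)
  have c: "1 - 2 * \<epsilon> \<notin> (\<lambda>_. 0) ` Basis" using eps by auto
  have "L (v i) \<bullet> shifted_inverse (frame_op {}) (1 - 2 * \<epsilon>) (L (v i)) = - (1 / (1 - 2 * \<epsilon>))"
    if "i \<in> {1..n}" for i
  proof -
    have "(\<Sum>e\<in>Basis. (L (v i) \<bullet> e)\<^sup>2) = 1"
      using unit that by (simp flip: parseval_norm[OF is_onb_Basis])
    then have "L (v i) \<bullet> shifted_inverse (frame_op {}) (1 - 2 * \<epsilon>) (L (v i)) = 1 / (0 - (1 - 2 * \<epsilon>))"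
      by (simp only: quadratic_shifted_inverse[OF c] flip: sum_divide_distrib)
    then show ?thesis by (simp only: diff_0 divide_minus_right)
  qed
  then show ?thesis by (simp add: potential_eq_sum_basis[OF lin basis c])
qed

definition loop_invariant :: "nat \<Rightarrow> 'a set \<Rightarrow> real \<Rightarrow> bool" where
  "loop_invariant k W b \<longleftrightarrow>
     b = 1 - 2 * \<epsilon> - real k * \<delta> \<and> selects L v n k W \<and> well_separated W b \<and>
     potential L (frame_op W) b \<le> - real n - 2 * (onorm L)\<^sup>2 / \<delta>"

text \<open>
  The invariant follows from the conditions on an iteration, so it holds whichever vectors are
  selected.
\<close>

lemma run_loop_invariant: "ss_run L v n \<epsilon> k W b \<Longrightarrow> loop_invariant k W b"
proof (induction rule: ss_run.induct)
  case start
  have "nonzero_eigenvalues (frame_op ({} :: 'a set)) = {}"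
    by (auto simp: nonzero_eigenvalues_def frame_op_def)
  then show ?case
    using eps initial_potential initial_potential_bound
    by (simp add: loop_invariant_def selects_def well_separated_def independent_empty)
next
  case (iterate k W b \<omega>)
  from iterate.IH have b: "b = 1 - 2 * \<epsilon> - real k * \<delta>" and sel: "selects L v n k W"
    and sep: "well_separated W b"
    and pot: "potential L (frame_op W) b \<le> - real n - 2 * (onorm L)\<^sup>2 / \<delta>"
    by (auto simp: loop_invariant_def)
  have "\<delta> < b - \<delta>" using iterate.hyps by (simp add: ss_applies_def)
  then have "0 < b - \<delta>" "b - \<delta> \<le> b" using delta_pos by auto
  then have sep': "well_separated W (b - \<delta>)" by (rule well_separated_lower[OF sep])
  have \<omega>: "\<omega> \<in> (\<lambda>i. L (v i)) ` {1..n}" "\<omega> \<notin> W"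
    "\<omega> \<bullet> shifted_inverse (frame_op W) (b - \<delta>) \<omega> < - 1"
    "potential L (\<lambda>x. frame_op W x + (\<omega> \<bullet> x) *\<^sub>R \<omega>) (b - \<delta>) \<le> potential L (frame_op W) b"
    using iterate.hyps by (auto simp: ss_choice_def)
  have "finite W" using sep by (auto simp: well_separated_def intro: independent_imp_finite)
  moreover have "well_separated (insert \<omega> W) (b - \<delta>)"
    by (rule well_separated_insert(2)[OF sep' \<omega>(3)])
  moreover have "potential L (frame_op (insert \<omega> W)) (b - \<delta>)
      \<le> - real n - 2 * (onorm L)\<^sup>2 / \<delta>"
    unfolding frame_op_insert[OF \<open>finite W\<close> \<omega>(2)] using \<omega>(4) pot by (rule order_trans)
  moreover have "selects L v n (Suc k) (insert \<omega> W)"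
    using sel \<omega>(1,2) \<open>finite W\<close> by (simp add: selects_def)
  moreover have "b - \<delta> = 1 - 2 * \<epsilon> - real (Suc k) * \<delta>" using b by (simp add: algebra_simps)
  ultimately show ?case unfolding loop_invariant_def by blast
qed

lemma run_well_separated: "ss_run L v n \<epsilon> k W b \<Longrightarrow> well_separated W b"
  using run_loop_invariant unfolding loop_invariant_def by blast

lemma run_applies:
  assumes run: "ss_run L v n \<epsilon> k W b" and b: "\<delta> < b - \<delta>"
  shows "ss_applies L n \<epsilon> W b"
proof -
  have inv: "loop_invariant k W b" by (rule run_loop_invariant[OF run])
  have sep: "well_separated W b" by (rule run_well_separated[OF run])
  obtain E ev where "frame_eigenbasis W E ev" using sep well_separated_eigenbasis by blast
  then have "num_nonzero_eigenvalues (frame_op W) = card W"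
    by (rule frame_eigenbasis.num_nonzero_eigenvalues_card)
  then show ?thesis
    using inv sep b unfolding ss_applies_def loop_invariant_def well_separated_def by blast
qed

lemma next_iteration:
  assumes run: "ss_run L v n \<epsilon> k W b" and b: "\<delta> < b - \<delta>"
  shows "\<exists>\<omega>. \<omega> \<notin> W \<and> ss_run L v n \<epsilon> (Suc k) (insert \<omega> W) (b - \<delta>) \<and>
    lower_riesz_bound (insert \<omega> W) b"
proof -
  have inv: "loop_invariant k W b" by (rule run_loop_invariant[OF run])
  have sep: "well_separated W b" by (rule run_well_separated[OF run])
  obtain E ev where E: "frame_eigenbasis W E ev" "eigenbasis.barrier E ev b"
    using well_separated_eigenbasis[OF sep] .
  interpret frame_eigenbasis W E ev by (rule E(1))
  have "L (v i) \<noteq> 0" if "i \<in> {1..n}" for i using unit that by fastforce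
  then obtain \<omega> where \<omega>: "\<omega> \<in> (\<lambda>i. L (v i)) ` {1..n}"
    "\<omega> \<bullet> shifted_inverse (frame_op W) b \<omega> \<le> - 1"
    "\<omega> \<bullet> shifted_inverse (frame_op W) (b - \<delta>) \<omega> < - 1"
    "potential L (\<lambda>x. frame_op W x + (\<omega> \<bullet> x) *\<^sub>R \<omega>) (b - \<delta>) \<le> potential L (frame_op W) b"
    using exists_selection[OF lin basis n_pos _ E(2) delta_pos b] inv
    unfolding loop_invariant_def by blast
  note new = riesz_bound_insert[OF sep \<omega>(2)]
  have "ss_choice L v n \<epsilon> W b \<omega>" using \<omega> new by (simp add: ss_choice_def)
  then have "ss_run L v n \<epsilon> (Suc k) (insert \<omega> W) (b - \<delta>)"
    by (rule ss_run.iterate[OF run run_applies[OF run b]])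
  with new show ?thesis by blast
qed

text \<open>
  The step with which to end when the barrier has come too low for another iteration: what counts is
  the average of the forms at \<open>b\<close>, and the potential bound puts it at or below \<open>-1\<close>.
\<close>

lemma extra_vector:
  assumes run: "ss_run L v n \<epsilon> k W b"
  shows "\<exists>\<omega>. selects L v n (Suc k) (insert \<omega> W) \<and> lower_riesz_bound (insert \<omega> W) b"
proof -
  have inv: "loop_invariant k W b" by (rule run_loop_invariant[OF run])
  have sep: "well_separated W b" by (rule run_well_separated[OF run])
  obtain E ev where E: "frame_eigenbasis W E ev" "eigenbasis.barrier E ev b"
    using well_separated_eigenbasis[OF sep] .
  interpret frame_eigenbasis W E ev by (rule E(1))
  have "0 \<le> 2 * (onorm L)\<^sup>2 / \<delta>" using delta_pos by simp
  then have "potential L (frame_op W) b \<le> - real n"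
    using inv unfolding loop_invariant_def by linarith
  then obtain i where i: "i \<in> {1..n}"
      "L (v i) \<bullet> shifted_inverse (frame_op W) b (L (v i)) \<le> - 1"
    using exists_vector_below[OF lin basis n_pos E(2)] by blast
  note new = riesz_bound_insert[OF sep i(2)]
  have "selects L v n (Suc k) (insert (L (v i)) W)"
    using inv i(1) new(1) finite_W by (auto simp: loop_invariant_def selects_def)
  with new(2) show ?thesis by blast
qed

lemma exists_run:
  assumes "k = 0 \<or> \<delta> < 1 - 2 * \<epsilon> - real k * \<delta>"
  shows "\<exists>W b. ss_run L v n \<epsilon> k W b"
  using assms
proof (induction k)
  case 0
  then show ?case using ss_run.start by blast
next
  case (Suc k)
  then have *: "\<delta> < 1 - 2 * \<epsilon> - real k * \<delta> - \<delta>" by (simp add: algebra_simps)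
  then have "\<delta> < 1 - 2 * \<epsilon> - real k * \<delta>" using delta_pos by linarith
  with Suc.IH obtain W b where run: "ss_run L v n \<epsilon> k W b" by blast
  have "b = 1 - 2 * \<epsilon> - real k * \<delta>"
    using run_loop_invariant[OF run] by (simp add: loop_invariant_def)
  with * next_iteration[OF run] show ?case by blast
qed

lemma run_barrier_gt:
  assumes "ss_run L v n \<epsilon> k W b" "0 < k"
  shows "\<delta> < b"
  using assms by cases (auto simp: ss_applies_def)

end

theorem corollary2p2:
  fixes L :: "'a::euclidean_space \<Rightarrow> 'a"
    and v :: "nat \<Rightarrow> 'a" and n :: nat and \<epsilon> :: real
  assumes basis: "orthonormal_basis v n"
    and lin: "linear L"
    and unit: "\<forall>i\<in>{1..n}. norm (L (v i)) = 1"
    and eps: "0 < \<epsilon>" "\<epsilon> < 1 / 2"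
  shows
    \<comment> \<open>\<open>k\<close> iterations can be carried out, and give \<open>k\<close> vectors with the stated bound\<close>
    "(\<forall>k\<ge>1. 1 - 2 * \<epsilon> - real k * ss_delta L n \<epsilon> > ss_delta L n \<epsilon> \<longrightarrow>
        (\<exists>W b. ss_run L v n \<epsilon> k W b \<and> selects L v n k W \<and>
               lower_riesz_bound W (1 - 2 * \<epsilon> - (real k - 1) * ss_delta L n \<epsilon>)))
     \<and>
     \<comment> \<open>whatever the first \<open>k - 1\<close> choices are, the \<open>k\<close>-th one can achieve the stated bound\<close>
     (\<forall>k\<ge>1. \<forall>W b. ss_run L v n \<epsilon> (k - 1) W b \<and> b - ss_delta L n \<epsilon> > ss_delta L n \<epsilon> \<longrightarrow>
        (\<exists>\<omega>. \<omega> \<notin> W \<and> ss_run L v n \<epsilon> k (insert \<omega> W) (b - ss_delta L n \<epsilon>) \<and>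
             selects L v n k (insert \<omega> W) \<and>
             lower_riesz_bound (insert \<omega> W) (1 - 2 * \<epsilon> - (real k - 1) * ss_delta L n \<epsilon>)))
     \<and>
     \<comment> \<open>every execution of \<open>k\<close> iterations gives \<open>k\<close> vectors with the final barrier as a bound\<close>
     (\<forall>k W b. ss_run L v n \<epsilon> k W b \<longrightarrow>
        b = 1 - 2 * \<epsilon> - real k * ss_delta L n \<epsilon> \<and> selects L v n k W \<and>
        num_nonzero_eigenvalues (frame_op W) = k \<and>
        (\<forall>\<mu>\<in>nonzero_eigenvalues (frame_op W). \<mu> > b) \<and> lower_riesz_bound W b)
     \<and>
     (\<forall>k\<ge>1. 1 - 2 * \<epsilon> - (real k - 1) * ss_delta L n \<epsilon>
        = (1 - 2 * \<epsilon>) * (1 - (real k - 1) * ((onorm L)\<^sup>2 / (\<epsilon> * real n))))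
     \<and>
     (\<forall>k. k = nat \<lceil>\<epsilon>\<^sup>2 * real n / (onorm L)\<^sup>2\<rceil> \<longrightarrow>
        (1 - 2 * \<epsilon>) * (1 - (real k - 1) * ((onorm L)\<^sup>2 / (\<epsilon> * real n)))
          \<ge> (1 - 2 * \<epsilon>) * (1 - (\<epsilon>\<^sup>2 * real n / (onorm L)\<^sup>2) * ((onorm L)\<^sup>2 / (\<epsilon> * real n))) \<and>
        (1 - 2 * \<epsilon>) * (1 - (\<epsilon>\<^sup>2 * real n / (onorm L)\<^sup>2) * ((onorm L)\<^sup>2 / (\<epsilon> * real n)))
          = (1 - 2 * \<epsilon>) * (1 - \<epsilon>) \<and>
        (\<exists>W. selects L v n k W \<and> lower_riesz_bound W ((1 - 2 * \<epsilon>) * (1 - \<epsilon>))))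
     \<and>
     (\<forall>k. k = nat \<lceil>\<epsilon> * real n / (onorm L)\<^sup>2\<rceil> \<longrightarrow>
        (1 - 2 * \<epsilon>) * (1 - (real k - 1) * ((onorm L)\<^sup>2 / (\<epsilon> * real n)))
          \<ge> (1 - 2 * \<epsilon>) * (1 - (\<epsilon> * real n / (onorm L)\<^sup>2) * ((onorm L)\<^sup>2 / (\<epsilon> * real n))) \<and>
        (1 - 2 * \<epsilon>) * (1 - (\<epsilon> * real n / (onorm L)\<^sup>2) * ((onorm L)\<^sup>2 / (\<epsilon> * real n)))
          = (1 - 2 * \<epsilon>) * 0 \<and>
        1 - 2 * \<epsilon> - real k * ss_delta L n \<epsilon> \<le> 0 \<and>
        \<not> (\<exists>W b. ss_run L v n \<epsilon> k W b))"
proof -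
  interpret restricted_invertibility L v n \<epsilon>
    using assms by (simp add: restricted_invertibility_def)
  \<comment> \<open>In terms of \<open>r\<close>, the two values of \<open>k\<close> are \<open>\<epsilon> / r\<close> and \<open>1 / r\<close>, rounded up.\<close>
  define r where "r = (onorm L)\<^sup>2 / (\<epsilon> * real n)"
  have r_pos: "0 < r" using onorm_pos n_pos eps by (simp add: r_def)
  have delta_r: "\<delta> = (1 - 2 * \<epsilon>) * r" by (simp add: delta_eq r_def)
  have ratio1: "\<epsilon>\<^sup>2 * real n / (onorm L)\<^sup>2 = \<epsilon> / r"
    and ratio2: "\<epsilon> * real n / (onorm L)\<^sup>2 = 1 / r"
    using onorm_pos n_pos eps by (simp_all add: r_def power2_eq_square)
  have run_properties: "b = 1 - 2 * \<epsilon> - real k * \<delta> \<and> selects L v n k W \<and>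
        num_nonzero_eigenvalues (frame_op W) = k \<and>
        (\<forall>\<mu>\<in>nonzero_eigenvalues (frame_op W). \<mu> > b) \<and> lower_riesz_bound W b"
    if run: "ss_run L v n \<epsilon> k W b" for k W b
  proof -
    have inv: "loop_invariant k W b" by (rule run_loop_invariant[OF run])
    have sep: "well_separated W b" by (rule run_well_separated[OF run])
    obtain E ev where "frame_eigenbasis W E ev" using sep well_separated_eigenbasis by blast
    then have "num_nonzero_eigenvalues (frame_op W) = card W"
      by (rule frame_eigenbasis.num_nonzero_eigenvalues_card)
    moreover have "lower_riesz_bound W b"
      using sep unfolding well_separated_def
      by (intro lower_riesz_bound_if_independent) (auto intro: less_imp_le)
    ultimately show ?thesis
      using inv sep unfolding loop_invariant_def selects_def well_separated_def by blast
  qed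
  have continuation: "\<exists>\<omega>. \<omega> \<notin> W \<and> ss_run L v n \<epsilon> k (insert \<omega> W) (b - \<delta>) \<and>
             selects L v n k (insert \<omega> W) \<and>
             lower_riesz_bound (insert \<omega> W) (1 - 2 * \<epsilon> - (real k - 1) * \<delta>)"
    if k: "1 \<le> k" and run: "ss_run L v n \<epsilon> (k - 1) W b" and b: "b - \<delta> > \<delta>" for k W b
  proof -
    obtain \<omega> where \<omega>: "\<omega> \<notin> W" "ss_run L v n \<epsilon> k (insert \<omega> W) (b - \<delta>)"
      "lower_riesz_bound (insert \<omega> W) b"
      using next_iteration[OF run b] k by auto
    moreover have "b = 1 - 2 * \<epsilon> - (real k - 1) * \<delta>"
      using run_properties[OF run] k by (simp add: of_nat_diff)
    ultimately show ?thesis using run_properties[OF \<omega>(2)] by blast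
  qed
  have existence: "\<exists>W b. ss_run L v n \<epsilon> k W b \<and> selects L v n k W \<and>
               lower_riesz_bound W (1 - 2 * \<epsilon> - (real k - 1) * \<delta>)"
    if k: "1 \<le> k" and room: "1 - 2 * \<epsilon> - real k * \<delta> > \<delta>" for k
  proof -
    have room': "1 - 2 * \<epsilon> - real (k - 1) * \<delta> - \<delta> > \<delta>"
      using room k by (simp add: of_nat_diff algebra_simps)
    then obtain W b where run: "ss_run L v n \<epsilon> (k - 1) W b"
      using exists_run[of "k - 1"] delta_pos by fastforce
    then have "b - \<delta> > \<delta>" using run_properties[OF run] room' by simp
    from continuation[OF k run this] show ?thesis by blast
  qed
  have bound_eq: "1 - 2 * \<epsilon> - (real k - 1) * \<delta> = (1 - 2 * \<epsilon>) * (1 - (real k - 1) * r)" for k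
    by (simp add: delta_r algebra_simps)
  have bourgain_tzafriri:
    "(1 - 2 * \<epsilon>) * (1 - (real k - 1) * r) \<ge> (1 - 2 * \<epsilon>) * (1 - \<epsilon> / r * r) \<and>
     (1 - 2 * \<epsilon>) * (1 - \<epsilon> / r * r) = (1 - 2 * \<epsilon>) * (1 - \<epsilon>) \<and>
     (\<exists>W. selects L v n k W \<and> lower_riesz_bound W ((1 - 2 * \<epsilon>) * (1 - \<epsilon>)))"
    if k: "k = nat \<lceil>\<epsilon> / r\<rceil>" for k
  proof -
    have "0 < \<epsilon> / r" using eps r_pos by simp
    then have k1: "1 \<le> k" and k_less: "real k - 1 < \<epsilon> / r"
      unfolding k by linarith+
    have k_r: "(real k - 1) * r < \<epsilon>" using k_less r_pos by (simp add: pos_less_divide_eq)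
    then have bound: "(1 - 2 * \<epsilon>) * (1 - \<epsilon>) \<le> (1 - 2 * \<epsilon>) * (1 - (real k - 1) * r)"
      using eps by (intro mult_left_mono) auto
    \<comment> \<open>It takes only \<open>k - 1\<close> iterations, followed by an extra vector.  For \<open>k = 2\<close> and \<open>\<epsilon>\<close> close to
       \<open>1 / 2\<close> there may be no room for a second iteration.\<close>
    have "k - 1 = 0 \<or> \<delta> < 1 - 2 * \<epsilon> - real (k - 1) * \<delta>"
    proof (cases "k = 1")
      case False
      then have "2 \<le> k" using k1 by simp
      \<comment> \<open>Here \<open>\<epsilon> < 1 / 2\<close> enters: \<open>2 (k - 1) r < 2 \<epsilon> < 1\<close>, and \<open>k \<le> 2 (k - 1)\<close>.\<close>
      have "real k * r \<le> (2 * (real k - 1)) * r"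
        using r_pos \<open>2 \<le> k\<close> by (intro mult_right_mono) auto
      also have "\<dots> < 1"
        using k_r eps by (simp add: algebra_simps)
      finally have "(1 - 2 * \<epsilon>) * (real k * r) < (1 - 2 * \<epsilon>) * 1"
        using eps by (intro mult_strict_left_mono) auto
      then show ?thesis using k1 by (simp add: delta_r of_nat_diff algebra_simps)
    qed simp
    then obtain W b where run: "ss_run L v n \<epsilon> (k - 1) W b" using exists_run by blast
    have b: "b = (1 - 2 * \<epsilon>) * (1 - (real k - 1) * r)"
      using run_properties[OF run] bound_eq[of k] k1 by (simp add: of_nat_diff)
    obtain \<omega> where "selects L v n k (insert \<omega> W)" "lower_riesz_bound (insert \<omega> W) b"
      using extra_vector[OF run] k1 by auto
    with bound b r_pos show ?thesis using lower_riesz_bound_mono by auto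
  qed
  have stop:
    "(1 - 2 * \<epsilon>) * (1 - (real k - 1) * r) \<ge> (1 - 2 * \<epsilon>) * (1 - 1 / r * r) \<and>
     (1 - 2 * \<epsilon>) * (1 - 1 / r * r) = (1 - 2 * \<epsilon>) * 0 \<and>
     1 - 2 * \<epsilon> - real k * \<delta> \<le> 0 \<and> \<not> (\<exists>W b. ss_run L v n \<epsilon> k W b)"
    if k: "k = nat \<lceil>1 / r\<rceil>" for k
  proof -
    have "0 < 1 / r" using r_pos by simp
    then have k1: "1 \<le> k" and k_less: "real k - 1 < 1 / r" and k_ge: "1 / r \<le> real k"
      unfolding k by linarith+
    have "(real k - 1) * r \<le> 1" using k_less r_pos by (simp add: pos_less_divide_eq)
    then have 1: "0 \<le> (1 - 2 * \<epsilon>) * (1 - (real k - 1) * r)"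
      using eps by (intro mult_nonneg_nonneg) auto
    have "1 \<le> real k * r" using k_ge r_pos by (simp add: pos_divide_le_eq)
    then have "(1 - 2 * \<epsilon>) * 1 \<le> (1 - 2 * \<epsilon>) * (real k * r)"
      using eps by (intro mult_left_mono) auto
    then have 2: "1 - 2 * \<epsilon> - real k * \<delta> \<le> 0" by (simp add: delta_r algebra_simps)
    have "\<not> ss_run L v n \<epsilon> k W b" for W b
    proof
      assume run: "ss_run L v n \<epsilon> k W b"
      \<comment> \<open>The last iteration was applicable, so it left a positive barrier.\<close>
      then have "\<delta> < b" using run_barrier_gt k1 by simp
      then show False using run_properties[OF run] 2 delta_pos by simp
    qed
    with 1 2 r_pos show ?thesis by simp
  qed
  show ?thesis
    unfolding r_def[symmetric] ratio1 ratio2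
    by (intro conjI)
     ((intro allI impI, rule existence, assumption+),
      (intro allI impI, elim conjE, rule continuation, assumption+),
      (intro allI impI, rule run_properties, assumption),
      (intro allI impI, rule bound_eq),
      (intro allI impI, rule bourgain_tzafriri, assumption),
      (intro allI impI, rule stop, assumption))
qed

end
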